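(* For each integer $m\ge1$ let $\gamma_T^{(m)}$ be the limit eigenvalue distribution of random block Toeplitz matrices with $m\times m$ blocks, as defined in the context. As $m\to\infty$, $\gamma_T^{(m)}$ converges weakly to the semicircle law, i.e. to the probability distribution on $\mathbb R$ with density $$w(x)=\begin{cases}\frac1{2\pi}\sqrt{4-x^2}&|x|\le2,\\0&|x|>2.\end{cases}$$
   Context: Definition of $\gamma_T^{(m)}$. $\gamma_T^{(m)}$ is the symmetric probability distribution on $\mathbb R$ determined by its even moments, for integers $k\ge1$, $$m_{2k}(\gamma_T^{(m)})=\int x^{2k}\,d\gamma_T^{(m)}=\sum_{\pi\in\mathcal P_2(2k)}m^{k-1-f(\pi)}\int_{[0,1]\times[-1,1]^k}\prod_{j=1}^{2k}I_{[0,1]}\Big(x_0+\sum_{q=1}^{j}\epsilon_\pi(q)\,x_{\pi(q)}\Big)\prod_{l=0}^{k}\mathrm d x_l$$ (all odd moments are zero). It is the almost sure weak limit, as $N\to\infty$, of the empirical eigenvalue distribution of $X_N=T_N/\sqrt{mN}$, where $T_N=(A_{i-j})_{i,j=1}^N$ is the $mN\times mN$ block matrix with $(i,j)$ block $A_{i-j}$, $A_s=(a_{ij}(s))_{i,j=1}^m$ real random $m\times m$ matrices ($-(N-1)\le s\le N-1$) with $A_{-s}=(A_s)^T$, entries independent apart from this symmetry, $E(a_{ij}(s))=0$, $E(|a_{ij}(s)|^2)=1$, and for every $k$, $\sup E|a_{ij}(s)|^k<\infty$ (supremum over all $i,j,s$, $N$ and $m$). Partitions. $[n]=\{1,\dots,n\}$.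 $\mathcal P_2(2k)$ is the set of partitions $\pi=\{V_1,\dots,V_k\}$ of $[2k]$ all of whose blocks have exactly two elements; the blocks are labelled and $\pi(q)=i$ means $q\in V_i$. Put $\epsilon_\pi(q)=1$ if $q$ is the smaller element of $V_{\pi(q)}$ and $\epsilon_\pi(q)=-1$ if $q$ is the larger element. For $\pi=\{V_1,\dots,V_k\}\in\mathcal P_2(2k)$ with $V_r=\{a_r,b_r\}$, $f(\pi)$ is the number of linearly independent equations (the rank) of the linear system in the unknowns $t_1,\dots,t_{2k}$ (with $t_{2k+1}=t_1$): $t_{a_i}=t_{b_i+1}$ and $t_{b_i}=t_{a_i+1}$ for $1\le i\le k$. $I_{[0,1]}$ is the indicator function of $[0,1]$. *)

theory Defs
  imports
    "HOL-Probability.Probability"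
    "HOL-Library.Disjoint_Sets"
    "Jordan_Normal_Form.DL_Rank"
begin

definition pair_partitions :: "nat \<Rightarrow> nat set set set" where
  "pair_partitions n = {P. partition_on {1..n} P \<and> (\<forall>V\<in>P. card V = 2)}"

definition block_of :: "nat set set \<Rightarrow> nat \<Rightarrow> nat set" where
  "block_of P q = (THE V. V \<in> P \<and> q \<in> V)"

(* The blocks are labelled V_1, ..., V_k in the order of their smallest elements, so block_label P q
   is the number written pi(q). Any other labelling only permutes the variables x_1, ..., x_k of
   toeplitz_integral below and gives the same value. *)
definition block_label :: "nat set set \<Rightarrow> nat \<Rightarrow> nat" where
  "block_label P q = card {V \<in> P. Min V \<le> Min (block_of P q)}"

definition block_sign :: "nat set set \<Rightarrow> nat \<Rightarrow> real" where
  "block_sign P q = (if q = Min (block_of P q) then 1 else - 1)"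

definition partner :: "nat set set \<Rightarrow> nat \<Rightarrow> nat" where
  "partner P q = (THE p. p \<noteq> q \<and> p \<in> block_of P q)"

(* The equations t_a = t_(b+1), t_b = t_(a+1), one pair for each block {a, b}, are together the
   equations t_q = t_(partner q + 1) for q = 1, ..., 2k. Matrix indices start at 0: row i is the
   equation with q = i + 1, and column j belongs to the unknown t_(j+1). Hence t_(p+1) has column
   p mod 2k, the reduction expressing t_(2k+1) = t_1. An equation whose two sides are the same
   unknown gives a zero row. *)
definition equation_matrix :: "nat \<Rightarrow> nat set set \<Rightarrow> real mat" where
  "equation_matrix k P = mat (2 * k) (2 * k)
     (\<lambda>(i, j). of_bool (j = i) - of_bool (j = partner P (i + 1) mod (2 * k)))"

definition equation_rank :: "nat \<Rightarrow> nat set set \<Rightarrow> nat" where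
  "equation_rank k P = vec_space.rank (2 * k) (equation_matrix k P)"

definition toeplitz_integral :: "nat \<Rightarrow> nat set set \<Rightarrow> real" where
  "toeplitz_integral k P =
     (LINT x : (\<Pi>\<^sub>E l\<in>{0..k}. if l = 0 then {0..1} else {-1..1}) | (\<Pi>\<^sub>M l\<in>{0..k}. lborel).
        (\<Prod>j = 1..2 * k.
           indicat_real {0..1} (x 0 + (\<Sum>q = 1..j. block_sign P q * x (block_label P q)))))"

(* The exponent k - 1 - f(pi) is a (non-positive) integer, hence powi. *)
definition toeplitz_moment :: "nat \<Rightarrow> nat \<Rightarrow> real" where
  "toeplitz_moment m k =
     (\<Sum>P\<in>pair_partitions (2 * k).
        real m powi (int k - 1 - int (equation_rank k P)) * toeplitz_integral k P)"

(* Symmetry of the measure includes the vanishing of all odd moments. *)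
definition is_block_toeplitz_law :: "nat \<Rightarrow> real measure \<Rightarrow> bool" where
  "is_block_toeplitz_law m M \<longleftrightarrow>
     real_distribution M \<and>
     distr M borel uminus = M \<and>
     (\<forall>k\<ge>1. integrable M (\<lambda>x. x ^ (2 * k)) \<and>
            (LINT x|M. x ^ (2 * k)) = toeplitz_moment m k)"

definition semicircle_density :: "real \<Rightarrow> real" where
  "semicircle_density x = (if \<bar>x\<bar> \<le> 2 then 1 / (2 * pi) * sqrt (4 - x\<^sup>2) else 0)"

definition semicircle_law :: "real measure" where
  "semicircle_law = density lborel (\<lambda>x. ennreal (semicircle_density x))"

end

theory Submission
  imports Defs
begin

text \<open>
  The proof is by the method of moments. The law \<open>\<gamma> m\<close> is symmetric, and its moment of order
  \<open>2 * k\<close> is a sum over the pairings of \<open>{1..2 * k}\<close>, in which the parameter \<open>m\<close> occurs only as a power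
  with exponent \<open>k - 1 - f(\<pi>)\<close>. Everything depends on the comparison of the rank \<open>f(\<pi>)\<close> with \<open>k - 1\<close>.

  Draw a pairing as arcs over the line. A solution \<open>t\<close> of the linear system is a closed walk that
  uses each arc once in each direction. At the right end of an arc it returns to a value that it had
  before, so it is determined by its initial value and its values at the \<open>k\<close> left ends. Hence the solution
  space has dimension at most \<open>k + 1\<close>, and the rank is at least \<open>k - 1\<close>. If no arcs cross, these values
  are free: a walk that is raised by \<open>1\<close> under one arc and is zero elsewhere is a solution. If arcs
  cross, there is a nontrivial relation among these values. So the rank is \<open>k - 1\<close> precisely for
  noncrossing pairings (\<open>rank_incidence_noncrossing\<close>, \<open>rank_incidence_crossing\<close>), and all other pairings
  disappear in the limit.

  For a noncrossing pairing the integral is \<open>1\<close>. The conditions at right ends repeat earlier ones, and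
  the condition at the \<open>i\<close>-th left end confines \<open>x\<^sub>i\<close> to an interval of length \<open>1\<close> whose position depends
  only on earlier variables (\<open>integral_heights_noncrossing\<close>). The moment of order \<open>2 * k\<close> therefore tends
  to the number of noncrossing pairings (\<open>toeplitz_moment_tendsto\<close>).

  That this number is the moment of the semicircle law is seen from a common recursion. Reading a pairing
  from left to right, one either opens an arc or closes the most recently opened one, so the number of open
  arcs performs a walk on the nonnegative integers (\<open>card_open_matchings\<close>). On the analytic side,
  multiplication by \<open>x\<close> takes a Chebyshev polynomial of the second kind to the sum of its two neighbours,
  and only the constant polynomial has nonzero integral against the semicircle
  density (\<open>integral_power_semicircle_mode\<close>). The semicircle law has bounded support, so its moments
  determine it and their convergence implies weak convergence (\<open>method_of_moments\<close>).
\<close>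

section \<open>Weak convergence from convergence of moments\<close>

text \<open>
  A Taylor polynomial of degree \<open>2 * k\<close> approximates each characteristic function with an error
  controlled by the moment of order \<open>2 * k\<close>. The moments of the limit grow at most geometrically, so
  for large \<open>k\<close> the factorial makes this error small for the limit, and then, by convergence of that
  single moment, for almost all members of the sequence. What remains is a polynomial in finitely many
  moments. Levy's continuity theorem turns pointwise convergence of the characteristic functions into
  weak convergence.
\<close>
theorem method_of_moments:
  fixes M :: "nat \<Rightarrow> real measure" and L :: "real measure" and B :: real
  assumes M: "\<And>n. real_distribution (M n)"
    and L: "real_distribution L"
    and int_M: "\<And>n k. integrable (M n) (\<lambda>x. x ^ k)"
    and int_L: "\<And>k. integrable L (\<lambda>x. x ^ k)"
    and conv: "\<And>k. (\<lambda>n. LINT x|M n. x ^ k) \<longlonglongrightarrow> (LINT x|L. x ^ k)"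
    and bound: "\<And>k. (LINT x|L. x ^ (2 * k)) \<le> B ^ (2 * k)"
  shows "weak_conv_m M L"
proof (rule levy_continuity[OF M L])
  fix t :: real
  define T where "T N m = (\<Sum>k\<le>m. (\<i> * t) ^ k / fact k * complex_of_real (LINT x|N. x ^ k))"
    for N :: "real measure" and m
  have taylor: "cmod (char N t - T N (2 * k)) \<le> 2 * \<bar>t\<bar> ^ (2 * k) / fact (2 * k) * (LINT x|N. x ^ (2 * k))"
    if "real_distribution N" "\<And>j. integrable N (\<lambda>x. x ^ j)" for N :: "real measure" and k
    using real_distribution.char_approx1[OF that(1), of "2 * k" t] that(2)
    by (simp add: T_def power_even_abs)
  show "(\<lambda>n. char (M n) t) \<longlonglongrightarrow> char L t"
  proof (rule tendstoI)
    fix e :: real assume e: "e > 0"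
    have "(\<lambda>n. (\<bar>t\<bar> * \<bar>B\<bar>) ^ n / fact n) \<longlonglongrightarrow> 0"
      using summable_LIMSEQ_zero[OF summable_exp[of "\<bar>t\<bar> * \<bar>B\<bar>"]] by (simp add: field_simps)
    then have "(\<lambda>k. (\<bar>t\<bar> * \<bar>B\<bar>) ^ (2 * k) / fact (2 * k)) \<longlonglongrightarrow> 0"
      by (rule LIMSEQ_subseq_LIMSEQ[unfolded comp_def]) (simp add: strict_mono_def)
    then have "\<forall>\<^sub>F k in sequentially. (\<bar>t\<bar> * \<bar>B\<bar>) ^ (2 * k) / fact (2 * k) < e / 8"
      using e by (intro order_tendstoD) auto
    then obtain k where k: "(\<bar>t\<bar> * \<bar>B\<bar>) ^ (2 * k) / fact (2 * k) < e / 8"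
      by (auto simp: eventually_sequentially)
    define C where "C = 2 * \<bar>t\<bar> ^ (2 * k) / fact (2 * k)"
    have C0: "C \<ge> 0" by (simp add: C_def)
    have "C * (LINT x|L. x ^ (2 * k)) \<le> C * \<bar>B\<bar> ^ (2 * k)"
      using bound[of k] C0 by (intro mult_left_mono) (simp_all add: power_even_abs)
    also have "\<dots> < e / 4"
      using k by (simp add: C_def power_mult_distrib field_simps)
    finally have small: "C * (LINT x|L. x ^ (2 * k)) < e / 4" .
    have "(\<lambda>n. C * (LINT x|M n. x ^ (2 * k))) \<longlonglongrightarrow> C * (LINT x|L. x ^ (2 * k))"
      by (intro tendsto_intros conv)
    then have ev1: "\<forall>\<^sub>F n in sequentially. C * (LINT x|M n. x ^ (2 * k)) < e / 4"
      using small by (rule order_tendstoD)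
    have "(\<lambda>n. T (M n) (2 * k)) \<longlonglongrightarrow> T L (2 * k)"
      unfolding T_def by (intro tendsto_intros conv)
    then have ev2: "\<forall>\<^sub>F n in sequentially. dist (T (M n) (2 * k)) (T L (2 * k)) < e / 4"
      using e by (intro tendstoD) auto
    show "\<forall>\<^sub>F n in sequentially. dist (char (M n) t) (char L t) < e"
      using ev1 ev2
    proof eventually_elim
      case (elim n)
      have "char (M n) t - char L t = (char (M n) t - T (M n) (2 * k))
          + (T (M n) (2 * k) - T L (2 * k)) - (char L t - T L (2 * k))"
        by simp
      also have "cmod \<dots> \<le> cmod (char (M n) t - T (M n) (2 * k))
          + cmod (T (M n) (2 * k) - T L (2 * k)) + cmod (char L t - T L (2 * k))"
        by (intro order_trans[OF norm_triangle_ineq4] add_right_mono norm_triangle_ineq)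
      finally show ?case
        using elim small taylor[OF M int_M, of n k] taylor[OF L int_L, of k] e
        unfolding C_def dist_norm by linarith
    qed
  qed
qed

section \<open>Moments of the semicircle law\<close>

text \<open>
  The product of the semicircle density and the \<open>h\<close>-th rescaled Chebyshev polynomial of the second
  kind: under \<open>x = 2 * cos \<theta>\<close> the factor \<open>sin \<theta>\<close> of the density cancels the denominator of
  \<open>sin ((h + 1) * \<theta>) / sin \<theta>\<close>. Keeping the product avoids a division by zero at the end points.
\<close>
definition semicircle_mode :: "nat \<Rightarrow> real \<Rightarrow> real" where
  "semicircle_mode h x = (if \<bar>x\<bar> \<le> 2 then sin (real (h + 1) * arccos (x / 2)) / pi else 0)"

lemma semicircle_mode_0: "semicircle_mode 0 = semicircle_density"
proof
  fix x :: real
  show "semicircle_mode 0 x = semicircle_density x"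
  proof (cases "\<bar>x\<bar> \<le> 2")
    case True
    have "1 - (x / 2)\<^sup>2 = (4 - x\<^sup>2) / 4" by (simp add: power_divide diff_divide_distrib)
    then have "sqrt (1 - (x / 2)\<^sup>2) = sqrt (4 - x\<^sup>2) / 2" by (simp only: real_sqrt_divide) simp
    moreover have "sin (arccos (x / 2)) = sqrt (1 - (x / 2)\<^sup>2)"
      using True by (intro sin_arccos_abs) simp
    ultimately have "sin (arccos (x / 2)) = sqrt (4 - x\<^sup>2) / 2" by (simp only:)
    note sin_eq = this
    have "semicircle_mode 0 x = sin (arccos (x / 2)) / pi"
      using True by (simp add: semicircle_mode_def)
    also have "\<dots> = semicircle_density x"
      unfolding sin_eq using True by (simp add: semicircle_density_def)
    finally show ?thesis .
  qed (simp add: semicircle_mode_def semicircle_density_def)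
qed

text \<open>
  The three-term recurrence of the Chebyshev polynomials: multiplication by \<open>x\<close> moves one step up or
  down in \<open>h\<close>, with no step below \<open>0\<close>.
\<close>
lemma times_semicircle_mode:
  "x * semicircle_mode h x = semicircle_mode (Suc h) x + (if h = 0 then 0 else semicircle_mode (h - 1) x)"
proof (cases "\<bar>x\<bar> \<le> 2")
  case True
  define \<theta> where "\<theta> = arccos (x / 2)"
  have x: "x = 2 * cos \<theta>" using True by (simp add: \<theta>_def)
  have *: "x * sin (real (h + 1) * \<theta>) = sin (real (h + 2) * \<theta>) + sin (real h * \<theta>)"
  proof -
    have "sin (real (h + 2) * \<theta>) = sin (real (h + 1) * \<theta> + \<theta>)"
      "sin (real h * \<theta>) = sin (real (h + 1) * \<theta> - \<theta>)"
      by (simp_all add: algebra_simps)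
    then show ?thesis by (simp only: sin_add sin_diff x) (simp add: algebra_simps)
  qed
  show ?thesis
  proof (cases "h = 0")
    case True
    then show ?thesis using * \<open>\<bar>x\<bar> \<le> 2\<close> by (simp add: semicircle_mode_def \<theta>_def)
  next
    case False
    then show ?thesis using * \<open>\<bar>x\<bar> \<le> 2\<close>
      by (simp add: semicircle_mode_def \<theta>_def add_divide_distrib[symmetric] numeral_eq_Suc)
  qed
qed (simp add: semicircle_mode_def)

text \<open>
  In the angle the integrand is a product of two sines, hence a difference of two cosines; for \<open>h \<noteq> 0\<close>
  both integrate to zero over \<open>[0, pi]\<close>.
\<close>
lemma semicircle_mode_has_integral:
  "(semicircle_mode h has_integral (if h = 0 then 1 else 0)) {-2..2}"
proof -
  \<comment> \<open>by \<open>2 * sin \<theta> * sin ((h + 1) * \<theta>) = cos (h * \<theta>) - cos ((h + 2) * \<theta>)\<close>, to be integrated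
    in \<open>\<theta>\<close>; the first cosine is constant for \<open>h = 0\<close>\<close>
  define F where "F x = (if h = 0 then - arccos (x / 2) else - sin (real h * arccos (x / 2)) / real h) / pi
     + sin (real (h + 2) * arccos (x / 2)) / (real (h + 2) * pi)" for x :: real
  have cont: "continuous_on {-2..2} F"
    unfolding F_def by (cases "h = 0") (auto intro!: continuous_intros)
  have deriv: "(F has_vector_derivative semicircle_mode h x) (at x)" if "x \<in> {-2<..<2}" for x
  proof -
    define \<theta> where "\<theta> = arccos (x / 2)"
    have x2: "x / 2 > -1" "x / 2 < 1" "\<bar>x / 2\<bar> \<le> 1" using that by auto
    have s: "sin \<theta> > 0" using x2 by (simp add: \<theta>_def sin_arccos_nonzero arccos_lt_bounded sin_gt_zero)
    have sq: "sqrt (1 - (x / 2)\<^sup>2) = sin \<theta>" using x2 by (simp add: \<theta>_def sin_arccos_abs)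
    have arc: "((\<lambda>x. arccos (x / 2)) has_real_derivative - 1 / (2 * sin \<theta>)) (at x)"
      using DERIV_chain2[OF DERIV_arccos[OF x2(1,2)] DERIV_cdivide[OF DERIV_ident, of 2]]
      by (simp add: sq inverse_eq_divide mult.commute)
    have scaled: "((\<lambda>x. sin (real n * arccos (x / 2)) / real n) has_real_derivative
        - cos (real n * \<theta>) / (2 * sin \<theta>)) (at x)" if "n > 0" for n :: nat
    proof -
      have "((\<lambda>x. sin (real n * arccos (x / 2))) has_real_derivative
          cos (real n * arccos (x / 2)) * (real n * (- 1 / (2 * sin \<theta>)))) (at x)"
        by (rule DERIV_chain2[where f = sin, OF DERIV_sin DERIV_cmult[OF arc]])
      from DERIV_cdivide[OF this, of "real n"] show ?thesis
        using that by (simp add: \<theta>_def)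
    qed
    define c where "c = - 1 / (2 * sin \<theta>)"
    have first: "((\<lambda>x. if h = 0 then - arccos (x / 2) else - sin (real h * arccos (x / 2)) / real h)
        has_real_derivative cos (real h * \<theta>) / (2 * sin \<theta>)) (at x)"
      using arc[THEN DERIV_minus] scaled[of h, THEN DERIV_minus] by (cases "h = 0") simp_all
    have "(F has_real_derivative cos (real h * \<theta>) / (2 * sin \<theta>) / pi
        + - cos (real (h + 2) * \<theta>) / (2 * sin \<theta>) / pi) (at x)"
      using DERIV_add[OF DERIV_cdivide[OF first, of pi] DERIV_cdivide[OF scaled[of "h + 2"], of pi]]
      unfolding F_def divide_divide_eq_left by simp
    moreover have "cos (real h * \<theta>) / (2 * sin \<theta>) / pi + - cos (real (h + 2) * \<theta>) / (2 * sin \<theta>) / pi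
        = semicircle_mode h x"
    proof -
      have "cos (real h * \<theta>) = cos (real (h + 1) * \<theta> - \<theta>)"
        "cos (real (h + 2) * \<theta>) = cos (real (h + 1) * \<theta> + \<theta>)"
        by (simp_all add: algebra_simps)
      then have "cos (real h * \<theta>) - cos (real (h + 2) * \<theta>) = 2 * sin \<theta> * sin (real (h + 1) * \<theta>)"
        by (simp only: cos_add cos_diff) simp
      moreover have "semicircle_mode h x = sin (real (h + 1) * \<theta>) / pi"
        using x2(3) by (simp add: semicircle_mode_def \<theta>_def)
      moreover have "a / (2 * sin \<theta>) / pi + - b / (2 * sin \<theta>) / pi = c / pi"
        if "a - b = 2 * sin \<theta> * c" for a b c
      proof -
        have "a = b + 2 * sin \<theta> * c" using that by simp
        then show ?thesis using s by (simp add: field_simps)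
      qed
      ultimately show ?thesis by simp
    qed
    ultimately show ?thesis
      by (simp add: has_real_derivative_iff_has_vector_derivative)
  qed
  have "F 2 - F (-2) = (if h = 0 then 1 else 0)"
    using sin_npi[of h] sin_npi[of "h + 2"] by (simp only: F_def) simp
  moreover have "(semicircle_mode h has_integral (F 2 - F (-2))) {-2..2}"
    using cont deriv by (intro fundamental_theorem_of_calculus_interior) auto
  ultimately show ?thesis by simp
qed

lemma semicircle_mode_zero_outside: "x \<notin> {-2..2} \<Longrightarrow> semicircle_mode h x = 0"
  by (auto simp: semicircle_mode_def abs_le_iff)

lemma integrable_power_semicircle_mode:
  "integrable lborel (\<lambda>x. x ^ n * semicircle_mode h x)"
proof -
  have "continuous_on {-2..2::real} (\<lambda>x. x ^ n * (sin (real (h + 1) * arccos (x / 2)) / pi))"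
    by (auto intro!: continuous_intros)
  from borel_integrable_compact[OF compact_Icc this]
  have "integrable lborel (\<lambda>x. indicator {-2..2} x *\<^sub>R (x ^ n * (sin (real (h + 1) * arccos (x / 2)) / pi)))" .
  also have "(\<lambda>x. indicator {-2..2} x *\<^sub>R (x ^ n * (sin (real (h + 1) * arccos (x / 2)) / pi)))
      = (\<lambda>x. x ^ n * semicircle_mode h x)"
    by (auto simp: semicircle_mode_def indicator_def abs_le_iff fun_eq_iff)
  finally show ?thesis .
qed

lemma integral_semicircle_mode:
  "(LINT x|lborel. semicircle_mode h x) = (if h = 0 then 1 else 0)"
proof -
  have "integrable lborel (semicircle_mode h)"
    using integrable_power_semicircle_mode[of 0 h] by simp
  then have "(semicircle_mode h has_integral (LINT x|lborel. semicircle_mode h x)) UNIV"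
    by (rule has_integral_integral_lborel)
  moreover have "(semicircle_mode h has_integral (if h = 0 then 1 else 0)) UNIV"
    using has_integral_on_superset[OF semicircle_mode_has_integral semicircle_mode_zero_outside subset_UNIV] .
  ultimately show ?thesis by (rule has_integral_unique)
qed

text \<open>
  The number of paths of \<open>n\<close> steps \<open>\<plusminus>1\<close> on the nonnegative integers from \<open>h\<close> to \<open>0\<close>. The value at
  \<open>(2 * k, 0)\<close> is the \<open>k\<close>-th Catalan number. The semicircle moments and the noncrossing pairings are
  matched through this recursion in two parameters.
\<close>
fun walks :: "nat \<Rightarrow> nat \<Rightarrow> nat" where
  "walks 0 h = (if h = 0 then 1 else 0)"
| "walks (Suc n) h = walks n (Suc h) + (if h = 0 then 0 else walks n (h - 1))"

lemma walks_odd: "odd (n + h) \<Longrightarrow> walks n h = 0"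
proof (induction n arbitrary: h)
  case (Suc n)
  have "odd (n + Suc h)" "h \<noteq> 0 \<Longrightarrow> odd (n + (h - 1))"
    using Suc.prems by (cases h; simp)+
  then show ?case using Suc.IH[of "Suc h"] Suc.IH[of "h - 1"] by (cases "h = 0") simp_all
qed (auto simp: odd_pos)

lemma walks_le: "walks n h \<le> 2 ^ n"
proof (induction n arbitrary: h)
  case (Suc n)
  show ?case using Suc[of "Suc h"] Suc[of "h - 1"] by (cases "h = 0") simp_all
qed simp

lemma integral_power_semicircle_mode:
  "(LINT x|lborel. x ^ n * semicircle_mode h x) = real (walks n h)"
proof (induction n arbitrary: h)
  case 0
  then show ?case by (simp add: integral_semicircle_mode)
next
  case (Suc n)
  have *: "x ^ Suc n * semicircle_mode h x = x ^ n * semicircle_mode (Suc h) x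
      + (if h = 0 then 0 else x ^ n * semicircle_mode (h - 1) x)" for x
    unfolding power_Suc2 mult.assoc times_semicircle_mode
    by (simp only: distrib_left if_distrib[of "(*) (x ^ n)"] mult_zero_right)
  show ?case
  proof (cases "h = 0")
    case True
    then show ?thesis unfolding * using Suc.IH[of "Suc h"] by simp
  next
    case False
    have "(LINT x|lborel. x ^ Suc n * semicircle_mode h x)
        = (LINT x|lborel. x ^ n * semicircle_mode (Suc h) x + x ^ n * semicircle_mode (h - 1) x)"
      unfolding * using False by (simp only: if_False)
    also have "\<dots> = real (walks n (Suc h)) + real (walks n (h - 1))"
      by (subst Bochner_Integration.integral_add) (simp_all only: integrable_power_semicircle_mode Suc.IH)
    finally show ?thesis using False by simp
  qed
qed

lemma semicircle_density_nonneg: "semicircle_density x \<ge> 0"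
proof -
  have "x\<^sup>2 \<le> 4" if "\<bar>x\<bar> \<le> 2"
    using power_mono[of "\<bar>x\<bar>" 2 2] that by simp
  then show ?thesis by (auto simp: semicircle_density_def)
qed

lemma semicircle_density_measurable[measurable]: "semicircle_density \<in> borel_measurable borel"
  unfolding semicircle_density_def[abs_def] by measurable

lemma semicircle_moments:
  shows integrable_semicircle_power: "integrable semicircle_law (\<lambda>x. x ^ n)"
    and semicircle_moment: "(LINT x|semicircle_law. x ^ n) = real (walks n 0)"
proof -
  have eq: "(\<lambda>x. semicircle_density x *\<^sub>R x ^ n) = (\<lambda>x. x ^ n * semicircle_mode 0 x)"
    by (simp add: semicircle_mode_0 fun_eq_iff)
  have power: "(\<lambda>x::real. x ^ n) \<in> borel_measurable lborel" by simp
  have density: "semicircle_density \<in> borel_measurable lborel" by simp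
  have nonneg: "AE x in lborel. 0 \<le> semicircle_density x"
    by (simp add: semicircle_density_nonneg)
  show "integrable semicircle_law (\<lambda>x. x ^ n)"
    unfolding semicircle_law_def integrable_density[OF power density nonneg] eq
    by (rule integrable_power_semicircle_mode)
  show "(LINT x|semicircle_law. x ^ n) = real (walks n 0)"
    unfolding semicircle_law_def integral_density[OF power density nonneg] eq
    by (rule integral_power_semicircle_mode)
qed

lemma real_distribution_semicircle: "real_distribution semicircle_law"
proof -
  have "emeasure semicircle_law UNIV = (\<integral>\<^sup>+ x. ennreal (semicircle_density x) \<partial>lborel)"
    unfolding semicircle_law_def by (subst emeasure_density) auto
  also have "\<dots> = ennreal (LINT x|lborel. semicircle_density x)"
    using integrable_power_semicircle_mode[of 0 0]
    by (intro nn_integral_eq_integral) (auto simp: semicircle_mode_0 semicircle_density_nonneg)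
  also have "\<dots> = 1"
    using integral_semicircle_mode[of 0] by (simp add: semicircle_mode_0)
  finally have "prob_space semicircle_law"
    by (intro prob_spaceI) (simp add: semicircle_law_def)
  then show ?thesis
    by (simp add: real_distribution_def real_distribution_axioms_def semicircle_law_def)
qed

section \<open>Counting noncrossing diagrams\<close>

text \<open>
  An involution is read as a diagram: \<open>a < f a\<close> is an arc, and a fixed point is an open end that waits
  for a partner further to the right. The clause \<open>f c \<noteq> c\<close> therefore forbids an open end beneath an arc.
\<close>
definition noncrossing :: "(nat \<Rightarrow> nat) \<Rightarrow> bool" where
  "noncrossing f \<longleftrightarrow> (\<forall>a c. a < c \<and> c < f a \<longrightarrow> a < f c \<and> f c < f a \<and> f c \<noteq> c)"

lemma noncrossingD:
  assumes "noncrossing f" "a < c" "c < f a"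
  shows "a < f c" "f c < f a" "f c \<noteq> c"
  using assms unfolding noncrossing_def by blast+

definition open_matchings :: "nat \<Rightarrow> nat \<Rightarrow> (nat \<Rightarrow> nat) set" where
  "open_matchings n h = {f. (\<forall>q. f (f q) = q) \<and> (\<forall>q. q \<notin> {1..n} \<longrightarrow> f q = q) \<and> noncrossing f
     \<and> card {q \<in> {1..n}. f q = q} = h}"

lemma open_matchingsI:
  assumes "\<And>q. f (f q) = q" "\<And>q. q \<notin> {1..n} \<Longrightarrow> f q = q" "noncrossing f"
    "card {q \<in> {1..n}. f q = q} = h"
  shows "f \<in> open_matchings n h"
  using assms by (simp add: open_matchings_def)

lemma open_matchingsD:
  assumes "f \<in> open_matchings n h"
  shows "f (f q) = q" "q \<notin> {1..n} \<Longrightarrow> f q = q" "noncrossing f" "card {q \<in> {1..n}. f q = q} = h"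
    and "f q \<noteq> q \<Longrightarrow> f q \<in> {1..n}"
  using assms unfolding open_matchings_def by (blast, blast, blast, blast, fastforce)

lemma finite_open_matchings: "finite (open_matchings n h)"
proof (rule finite_subset)
  show "open_matchings n h \<subseteq> {f. f permutes {1..n}}"
    unfolding permutes_def by (auto simp: open_matchings_def) metis+
qed (simp add: finite_permutations)

text \<open>
  Removal of the last point from a diagram in which it has a partner; that partner becomes an open end.
\<close>
definition cut_last :: "nat \<Rightarrow> (nat \<Rightarrow> nat) \<Rightarrow> nat \<Rightarrow> nat" where
  "cut_last n g = g(g (Suc n) := g (Suc n), Suc n := Suc n)"

text \<open>
  Only the rightmost open end can be closed without enclosing another open end.
\<close>
definition join_last :: "nat \<Rightarrow> (nat \<Rightarrow> nat) \<Rightarrow> nat \<Rightarrow> nat" where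
  "join_last n f = (let s = Max {q \<in> {1..n}. f q = q} in f(s := Suc n, Suc n := s))"

lemma cut_last_in_open_matchings:
  assumes g: "g \<in> open_matchings (Suc n) h" and last: "g (Suc n) \<noteq> Suc n"
  shows "cut_last n g \<in> open_matchings n (Suc h)" "Max {q \<in> {1..n}. cut_last n g q = q} = g (Suc n)"
proof -
  note gD = open_matchingsD[OF g]
  define s where "s = g (Suc n)"
  have gs: "g s = Suc n" by (simp add: s_def gD)
  have s: "s \<noteq> Suc n" "s \<in> {1..Suc n}" using last gD(5)[of "Suc n"] by (simp_all add: s_def)
  have cut: "cut_last n g q = (if q = s \<or> q = Suc n then q else g q)" for q
    by (simp add: cut_last_def s_def)
  have g_eq: "g q = s \<longleftrightarrow> q = Suc n" "g q = Suc n \<longleftrightarrow> q = s" for q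
    using gD(1)[of q] gD(1) gs s_def by metis+
  have fixed: "{q \<in> {1..n}. cut_last n g q = q} = insert s {q \<in> {1..Suc n}. g q = q}"
    using s last by (auto simp: cut gs le_Suc_eq)
  show "Max {q \<in> {1..n}. cut_last n g q = q} = g (Suc n)"
    unfolding fixed s_def[symmetric]
  proof (rule Max_eqI)
    fix q assume q: "q \<in> insert s {q \<in> {1..Suc n}. g q = q}"
    show "q \<le> s"
    proof (rule ccontr)
      assume "\<not> q \<le> s"
      then show False
        using q last noncrossingD(3)[OF gD(3), of s q] gs by (cases "q = Suc n") auto
    qed
  qed auto
  show "cut_last n g \<in> open_matchings n (Suc h)"
  proof (rule open_matchingsI)
    show "noncrossing (cut_last n g)"
      unfolding noncrossing_def
    proof (intro allI impI, elim conjE)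
      fix a c assume ac: "a < c" "c < cut_last n g a"
      then have ga: "cut_last n g a = g a" "g a \<noteq> a" by (auto simp: cut split: if_splits)
      then have "g a \<le> Suc n" using gD(5)[of a] by simp
      with ac ga have "c \<noteq> s" "c \<noteq> Suc n"
        using noncrossingD(2)[OF gD(3), of a c] gs by auto
      then show "a < cut_last n g c \<and> cut_last n g c < cut_last n g a \<and> cut_last n g c \<noteq> c"
        using noncrossingD[OF gD(3), of a c] ac ga by (simp add: cut)
    qed
    show "card {q \<in> {1..n}. cut_last n g q = q} = Suc h"
      unfolding fixed using gD(4) gs s by simp
  qed (use s in \<open>auto simp: cut g_eq gD(1) le_Suc_eq intro!: gD(2)\<close>)
qed

lemma join_last_in_open_matchings:
  assumes f: "f \<in> open_matchings n (Suc h)"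
  shows "join_last n f \<in> open_matchings (Suc n) h" "join_last n f (Suc n) \<noteq> Suc n"
    and "join_last n f (Suc n) = Max {q \<in> {1..n}. f q = q}"
proof -
  note fD = open_matchingsD[OF f]
  define F where "F = {q \<in> {1..n}. f q = q}"
  define s where "s = Max F"
  have card_F: "card F = Suc h" using fD(4) by (simp add: F_def)
  then have F: "finite F" "F \<noteq> {}" by (auto simp: card_ge_0_finite)
  have s: "s \<in> F" unfolding s_def using F by (rule Max_in)
  have s_max: "q \<le> s" if "q \<in> F" for q using that F by (simp add: s_def)
  have fs: "f s = s" "s \<in> {1..n}" using s by (auto simp: F_def)
  have join: "join_last n f q = (if q = s then Suc n else if q = Suc n then s else f q)" for q
  proof -
    have "Max {q \<in> {1..n}. f q = q} = s" by (simp only: s_def F_def)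
    then show ?thesis using fs unfolding join_last_def Let_def by simp
  qed
  show "join_last n f (Suc n) = Max {q \<in> {1..n}. f q = q}" "join_last n f (Suc n) \<noteq> Suc n"
    using fs(2) by (simp_all only: join s_def F_def) auto
  have f_eq: "f q = s \<longleftrightarrow> q = s" "f q = Suc n \<longleftrightarrow> q = Suc n" for q
    using fD(1)[of q] fD(2)[of "Suc n"] fs(1) by (metis, force)
  show "join_last n f \<in> open_matchings (Suc n) h"
  proof (rule open_matchingsI)
    have "{q \<in> {1..Suc n}. join_last n f q = q} = F - {s}"
      using fs by (auto simp: join F_def le_Suc_eq split: if_splits)
    then show "card {q \<in> {1..Suc n}. join_last n f q = q} = h"
      using s card_F by (simp add: card_Diff_singleton)
    show "noncrossing (join_last n f)"
      unfolding noncrossing_def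
    proof (intro allI impI, elim conjE)
      fix a c assume ac: "a < c" "c < join_last n f a"
      show "a < join_last n f c \<and> join_last n f c < join_last n f a \<and> join_last n f c \<noteq> c"
      proof (cases "a = s")
        case True
        with ac have c: "s < c" "c \<le> n" by (auto simp: join)
        then have "f c \<noteq> c" using s_max[of c] fs by (auto simp: F_def)
        moreover have "f c \<noteq> s" "\<not> f c < s"
          using c f_eq(1)[of c] noncrossingD(3)[OF fD(3), of "f c" s] fs fD(1)[of c] by auto
        ultimately show ?thesis using True c fD(5)[of c] by (auto simp: join)
      next
        case False
        with ac fs have a: "join_last n f a = f a" "a < c" "c < f a"
          by (auto simp: join split: if_splits)
        then have "f a \<le> n" using fD(5)[of a] by auto
        moreover have "c \<noteq> s" using noncrossingD(3)[OF fD(3) a(2,3)] fs by auto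
        ultimately show ?thesis using noncrossingD[OF fD(3) a(2,3)] a by (simp add: join)
      qed
    qed
  qed (use fs in \<open>auto simp: join f_eq fD(1) intro!: fD(2)\<close>)
qed

text \<open>
  The point \<open>Suc n\<close> is either a new open end or the partner of the rightmost open end among the earlier
  points. Deleting it leaves a diagram on \<open>{1..n}\<close> with one open end less or one more, which is the
  recursion of \<^const>\<open>walks\<close>. No relabelling of points is involved.
\<close>
theorem card_open_matchings: "card (open_matchings n h) = walks n h"
proof (induction n arbitrary: h)
  case 0
  have "open_matchings 0 h = (if h = 0 then {id} else {})"
    by (auto simp: open_matchings_def noncrossing_def fun_eq_iff)
  then show ?case by simp
next
  case (Suc n)
  define A where "A = {f \<in> open_matchings (Suc n) h. f (Suc n) = Suc n}"
  define B where "B = {f \<in> open_matchings (Suc n) h. f (Suc n) \<noteq> Suc n}"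
  have "A = (if h = 0 then {} else open_matchings n (h - 1))"
  proof -
    have fixed: "card {q \<in> {1..Suc n}. f q = q} = Suc (card {q \<in> {1..n}. f q = q})"
      if "f (Suc n) = Suc n" for f :: "nat \<Rightarrow> nat"
    proof -
      have "{q \<in> {1..Suc n}. f q = q} = insert (Suc n) {q \<in> {1..n}. f q = q}"
        using that by (auto simp: le_Suc_eq)
      then show ?thesis by simp
    qed
    have "f \<in> A \<longleftrightarrow> h \<noteq> 0 \<and> f \<in> open_matchings n (h - 1)" for f
    proof (cases "f (Suc n) = Suc n")
      case True
      then have "(\<forall>q. q \<notin> {1..Suc n} \<longrightarrow> f q = q) \<longleftrightarrow> (\<forall>q. q \<notin> {1..n} \<longrightarrow> f q = q)"
        by (auto simp: le_Suc_eq)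
      then show ?thesis using fixed[of f, OF True] True
        unfolding A_def open_matchings_def by (cases h) auto
    next
      case False
      then show ?thesis
        using open_matchingsD(2)[of f n "h - 1" "Suc n"] by (auto simp: A_def)
    qed
    then show ?thesis by auto
  qed
  then have card_A: "card A = (if h = 0 then 0 else walks n (h - 1))"
    using Suc.IH by simp
  have "bij_betw (cut_last n) B (open_matchings n (Suc h))"
  proof (rule bij_betwI)
    show "cut_last n \<in> B \<rightarrow> open_matchings n (Suc h)"
      by (auto simp: B_def intro: cut_last_in_open_matchings)
    show "join_last n \<in> open_matchings n (Suc h) \<rightarrow> B"
      using join_last_in_open_matchings by (auto simp: B_def)
    show "join_last n (cut_last n g) = g" if "g \<in> B" for g
    proof -
      have g: "g \<in> open_matchings (Suc n) h" "g (Suc n) \<noteq> Suc n" using that by (auto simp: B_def)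
      show ?thesis
        unfolding join_last_def cut_last_in_open_matchings(2)[OF g] Let_def
        by (simp add: cut_last_def fun_eq_iff open_matchingsD(1)[OF g(1)])
    qed
    show "cut_last n (join_last n f) = f" if f: "f \<in> open_matchings n (Suc h)" for f
    proof -
      let ?s = "join_last n f (Suc n)"
      have s: "?s \<noteq> Suc n" "?s = Max {q \<in> {1..n}. f q = q}"
        using join_last_in_open_matchings[OF f] by auto
      have "f ?s = ?s"
      proof -
        have "{q \<in> {1..n}. f q = q} \<noteq> {}"
          using open_matchingsD(4)[OF f] by (metis card.empty nat.distinct(1))
        from Max_in[OF _ this] show ?thesis by (simp add: s(2))
      qed
      moreover have "f (Suc n) = Suc n" using open_matchingsD(2)[OF f, of "Suc n"] by simp
      moreover have "join_last n f = f(?s := Suc n, Suc n := ?s)"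
        by (simp add: s(2)) (simp add: join_last_def Let_def)
      ultimately show ?thesis
        unfolding cut_last_def by (metis fun_upd_twist fun_upd_upd fun_upd_triv s(1))
    qed
  qed
  then have card_B: "card B = walks n (Suc h)"
    using Suc.IH by (simp add: bij_betw_same_card)
  have "open_matchings (Suc n) h = A \<union> B" "A \<inter> B = {}" by (auto simp: A_def B_def)
  then have "card (open_matchings (Suc n) h) = card A + card B"
    using finite_open_matchings[of "Suc n" h] by (simp add: card_Un_disjoint)
  then show ?case using card_A card_B by simp
qed

section \<open>Bounds for the rank of a matrix\<close>

text \<open>
  A linear relation among the columns in \<open>J\<close> is a kernel vector supported on \<open>J\<close>, so the hypothesis
  says that these columns are independent.
\<close>
lemma (in vec_space) card_le_rank:
  assumes A: "A \<in> carrier_mat n nc" and J: "J \<subseteq> {..<nc}"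
    and kernel: "\<And>u j. (\<And>j. j \<notin> J \<Longrightarrow> u j = 0) \<Longrightarrow>
        (\<And>i. i < n \<Longrightarrow> (\<Sum>j<nc. A $$ (i, j) * u j) = 0) \<Longrightarrow> j \<in> J \<Longrightarrow> u j = 0"
  shows "card J \<le> rank A"
proof -
  have fin: "finite J" using J finite_subset by blast
  have cols: "col A ` J \<subseteq> set (cols A)"
    using A J by (auto simp: cols_def)
  have carrier: "col A ` J \<subseteq> carrier_vec n" using A J by auto
  have entry: "vec_index (col A j) i = A $$ (i, j)" if "i < n" "j \<in> J" for i j
    using A J that by (auto simp: col_def)
  have extend: "(\<Sum>j<nc. A $$ (i, j) * u j) = (\<Sum>j\<in>J. A $$ (i, j) * u j)"
    if "\<And>j. j \<notin> J \<Longrightarrow> u j = 0" for u i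
    by (rule sum.mono_neutral_right) (use J that in auto)
  have inj: "inj_on (col A) J"
  proof (rule inj_onI, rule ccontr)
    fix p q assume pq: "p \<in> J" "q \<in> J" "col A p = col A q" "p \<noteq> q"
    \<comment> \<open>two equal columns would give this kernel vector\<close>
    define u :: "nat \<Rightarrow> 'a" where "u j = (if j = p then 1 else if j = q then - 1 else 0)" for j
    have supp: "u j = 0" if "j \<notin> J" for j using that pq by (auto simp: u_def)
    have "(\<Sum>j<nc. A $$ (i, j) * u j) = 0" if i: "i < n" for i
    proof -
      have "(\<Sum>j<nc. A $$ (i, j) * u j) = (\<Sum>j\<in>{p, q}. A $$ (i, j) * u j)"
        by (rule sum.mono_neutral_right) (use J pq in \<open>auto simp: u_def\<close>)
      also have "\<dots> = A $$ (i, p) - A $$ (i, q)" using pq by (simp add: u_def)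
      also have "\<dots> = 0" using entry[OF i] pq by (metis diff_self)
      finally show ?thesis .
    qed
    from kernel[of u, OF supp this pq(1)] show False by (simp add: u_def)
  qed
  have "lin_indpt (col A ` J)"
  proof (rule finite_lin_indpt2)
    fix a assume a: "lincomb a (col A ` J) = 0\<^sub>v n"
    define u where "u j = (if j \<in> J then a (col A j) else 0)" for j
    have supp: "u j = 0" if "j \<notin> J" for j using that by (simp add: u_def)
    have "(\<Sum>j<nc. A $$ (i, j) * u j) = 0" if i: "i < n" for i
    proof -
      have "(\<Sum>j<nc. A $$ (i, j) * u j) = (\<Sum>j\<in>J. A $$ (i, j) * u j)"
        by (rule extend[OF supp])
      also have "\<dots> = (\<Sum>j\<in>J. a (col A j) * vec_index (col A j) i)"
        by (rule sum.cong) (simp_all add: u_def entry i mult.commute)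
      also have "\<dots> = vec_index (lincomb a (col A ` J)) i"
        using lincomb_index[OF i carrier, of a] by (simp add: sum.reindex[OF inj])
      also have "\<dots> = 0" using a i by simp
      finally show ?thesis .
    qed
    then have "u j = 0" if "j \<in> J" for j using kernel[of u, OF supp] that by blast
    then show "\<forall>v\<in>col A ` J. a v = 0" by (auto simp: u_def)
  qed (use fin carrier in auto)
  from rank_ge_card_indpt[OF A cols this] show ?thesis by (simp add: card_image[OF inj])
qed

lemma (in vec_space) rank_le_card:
  assumes A: "A \<in> carrier_mat n nc" and J: "J \<subseteq> {..<nc}"
    and span: "\<And>j. j < nc \<Longrightarrow> col A j \<in> span (col A ` J)"
  shows "rank A \<le> card J"
proof -
  have fin: "finite J" using J finite_subset by blast
  let ?U = "col A ` J"
  have carrier: "?U \<subseteq> carrier_vec n" using A J by auto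
  have cols: "set (cols A) = col A ` {..<nc}"
    using A by (auto simp: cols_def lessThan_atLeast0)
  have "span (set (cols A)) = span ?U"
  proof
    show "span (set (cols A)) \<subseteq> span ?U"
      using span by (intro span_subsetI carrier) (auto simp: cols)
    show "span ?U \<subseteq> span (set (cols A))"
      using J by (intro span_is_monotone) (auto simp: cols)
  qed
  moreover have "vectorspace.dim class_ring (span_vs ?U) \<le> card ?U"
  proof (rule vectorspace.gen_ge_dim)
    show "vectorspace class_ring (span_vs ?U)"
      using carrier by (intro subspace_is_vs span_is_subspace) simp
    show "?U \<subseteq> carrier (span_vs ?U)" using carrier in_own_span by auto
    show "module.gen_set class_ring (span_vs ?U) ?U"
      using span_li_not_depend(1)[of ?U "span ?U"] carrier in_own_span[of ?U] span_is_submodule[of ?U] by simp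
  qed (use fin in simp)
  ultimately have "rank A \<le> card ?U" by (simp add: rank_def)
  also have "\<dots> \<le> card J" using fin by (rule card_image_le)
  finally show ?thesis .
qed

lemma (in vec_space) neg_sum_in_span:
  assumes U: "U \<subseteq> carrier_vec n" and T: "finite T" "\<And>i. i \<in> T \<Longrightarrow> v i \<in> span U"
    and w: "w \<in> carrier_vec n" "\<And>r. r < n \<Longrightarrow> vec_index w r = - (\<Sum>i\<in>T. vec_index (v i) r)"
  shows "w \<in> span U"
  using T w
proof (induction T arbitrary: w rule: finite_induct)
  case empty
  then have "w = 0\<^sub>v n" by (intro eq_vecI) auto
  also have "0\<^sub>v n \<in> span U" by (rule in_spanI[of _ "\<lambda>_. 0" "{}"]) (simp_all add: lincomb_def)
  finally show ?case .
next
  case (insert x T)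
  have x: "v x \<in> span U" "v x \<in> carrier_vec n"
    using insert.prems(1)[of x] span_is_subset2 U by auto
  have "w + v x \<in> span U"
  proof (rule insert.IH)
    show "v i \<in> span U" if "i \<in> T" for i using insert.prems(1)[of i] that by simp
    show "w + v x \<in> carrier_vec n" using insert.prems(2) x(2) by simp
    fix r assume r: "r < n"
    have "dim_vec w = n" "dim_vec (v x) = n" using insert.prems(2) x(2) by auto
    then show "vec_index (w + v x) r = - (\<Sum>i\<in>T. vec_index (v i) r)"
      using insert.prems(3)[OF r] insert.hyps r by simp
  qed
  moreover have "(- 1) \<cdot>\<^sub>v v x \<in> span U" using smult_in_span[OF U x(1)] .
  ultimately have "(w + v x) + (- 1) \<cdot>\<^sub>v v x \<in> span U"
    using span_add1[of U] U by simp
  moreover have "(w + v x) + (- 1) \<cdot>\<^sub>v v x = w"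
    using insert.prems(2) x(2) by (intro eq_vecI) auto
  ultimately show ?case by simp
qed

section \<open>The rank of the equations of a pairing\<close>

text \<open>
  A fixed-point-free involution of \<open>{1..n}\<close>, extended by the identity so that \<open>f (f q) = q\<close> holds
  without side condition.
\<close>
locale pairing =
  fixes n :: nat and f :: "nat \<Rightarrow> nat"
  assumes mate_mate: "f (f q) = q"
    and mate_outside: "q \<notin> {1..n} \<Longrightarrow> f q = q"
    and mate_inside: "q \<in> {1..n} \<Longrightarrow> f q \<noteq> q"
begin

definition openers :: "nat set" where "openers = {q \<in> {1..n}. q < f q}"
definition closers :: "nat set" where "closers = {q \<in> {1..n}. f q < q}"

lemma mate_in_iff: "f q \<in> {1..n} \<longleftrightarrow> q \<in> {1..n}"
  using mate_mate mate_outside by metis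

lemma mate_eq_iff: "f p = q \<longleftrightarrow> p = f q"
  using mate_mate by metis

lemma openers_un_closers: "openers \<union> closers = {1..n}" "openers \<inter> closers = {}"
proof -
  have *: "f q < q \<or> q < f q" if "q \<in> {1..n}" for q using mate_inside[OF that] by linarith
  show "openers \<union> closers = {1..n}" using * unfolding openers_def closers_def by blast
  show "openers \<inter> closers = {}" by (auto simp: openers_def closers_def)
qed

lemma finite_openers[simp]: "finite openers" and finite_closers[simp]: "finite closers"
  by (simp_all add: openers_def closers_def)

lemma mate_openers: "f ` openers = closers"
proof -
  have "f q \<in> closers" if "q \<in> openers" for q
    using that mate_in_iff[of q] by (simp add: openers_def closers_def mate_mate)
  moreover have "f q \<in> openers" if "q \<in> closers" for q
    using that mate_in_iff[of q] by (simp add: openers_def closers_def mate_mate)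
  moreover have "closers = f ` f ` closers" by (simp add: image_image mate_mate)
  ultimately show ?thesis by blast
qed

lemma card_openers: "n = 2 * card openers" and card_closers: "card closers = card openers"
proof -
  have "inj_on f openers" by (metis inj_onI mate_mate)
  then show closers: "card closers = card openers"
    by (simp add: card_image flip: mate_openers)
  have "card openers + card closers = card {1..n}"
    using card_Un_disjoint[OF finite_openers finite_closers openers_un_closers(2)] openers_un_closers(1)
    by simp
  then show "n = 2 * card openers" using closers by simp
qed

lemma last_in_closers: "n > 0 \<Longrightarrow> n \<in> closers"
  using mate_inside[of n] mate_in_iff[of n] by (auto simp: closers_def)

text \<open>
  The coefficient matrix of the equations \<open>t q = t (f q + 1)\<close> with \<open>t (n + 1) = t 1\<close>: row \<open>i\<close> belongs to
  \<open>q = i + 1\<close>, and column \<open>j\<close> to the unknown \<open>t (j + 1)\<close>. In the lemmas below, the value \<open>u j\<close> of this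
  unknown is regarded as the height after \<open>j\<close> steps of a closed walk. The kernel condition then says that
  step \<open>f q\<close> of the walk undoes step \<open>q\<close>.
\<close>
definition incidence :: "real mat" where
  "incidence = mat n n (\<lambda>(i, j). of_bool (j = i) - of_bool (j = f (i + 1) mod n))"

lemma incidence_carrier: "incidence \<in> carrier_mat n n"
  by (simp add: incidence_def)

lemma incidence_row:
  assumes "i < n"
  shows "(\<Sum>j<n. incidence $$ (i, j) * u j) = u i - u (f (i + 1) mod n)"
proof -
  have "(\<Sum>j<n. incidence $$ (i, j) * u j)
      = (\<Sum>j<n. (if j = i then u j else 0) - (if j = f (i + 1) mod n then u j else 0))"
    using assms by (intro sum.cong) (auto simp: incidence_def)
  also have "\<dots> = u i - u (f (i + 1) mod n)"
    using assms by (simp add: sum_subtractf)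
  finally show ?thesis .
qed

lemma kernel_step:
  assumes "\<And>i. i < n \<Longrightarrow> (\<Sum>j<n. incidence $$ (i, j) * u j) = 0"
    and "q \<in> {1..n}" "f q < n"
  shows "u (q - 1) = u (f q)"
  using assms(1)[of "q - 1"] assms(2,3) incidence_row[of "q - 1" u] by auto

lemma kernel_step_closer:
  assumes "\<And>i. i < n \<Longrightarrow> (\<Sum>j<n. incidence $$ (i, j) * u j) = 0"
    and "j \<in> closers" "j < n"
  shows "u j = u (f j - 1)"
  using kernel_step[OF assms(1), of "f j"] assms(2,3) mate_in_iff[of j]
  by (simp add: closers_def mate_mate)

text \<open>
  A closer repeats a height that occurred earlier, so a kernel vector is determined by its values at \<open>0\<close>
  and at the openers.
\<close>
lemma kernel_zero:
  assumes kernel: "\<And>i. i < n \<Longrightarrow> (\<Sum>j<n. incidence $$ (i, j) * u j) = 0"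
    and zero: "\<And>j. j \<notin> closers \<Longrightarrow> u j = 0"
  shows "j < n \<Longrightarrow> u j = 0"
proof (induction j rule: less_induct)
  case (less j)
  show ?case
  proof (cases "j \<in> closers")
    case True
    moreover from this have "f j - 1 < j" by (auto simp: closers_def)
    ultimately show ?thesis
      using less.IH[of "f j - 1"] kernel_step_closer[OF kernel True less.prems] less.prems by simp
  qed (rule zero)
qed

text \<open>
  Every closer except \<open>n\<close> contributes an independent column. The closer \<open>n\<close> is excluded because it
  is not a column: height \<open>n\<close> is height \<open>0\<close>.
\<close>
lemma rank_incidence_ge: "card openers - 1 \<le> vec_space.rank n incidence"
proof (cases "n = 0")
  case False
  interpret vec_space "TYPE(real)" n .
  have "card (closers - {n}) \<le> rank incidence"
  proof (rule card_le_rank[OF incidence_carrier])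
    show "closers - {n} \<subseteq> {..<n}" by (auto simp: closers_def)
    fix u :: "nat \<Rightarrow> real" and j
    assume u: "\<And>j. j \<notin> closers - {n} \<Longrightarrow> u j = 0"
      and kernel: "\<And>i. i < n \<Longrightarrow> (\<Sum>j<n. incidence $$ (i, j) * u j) = 0"
      and j: "j \<in> closers - {n}"
    show "u j = 0"
      by (rule kernel_zero[OF kernel u]) (use j in \<open>auto simp: closers_def\<close>)
  qed
  then show ?thesis
    using False last_in_closers card_closers by (simp add: card_Diff_singleton)
qed (use card_openers in simp)

text \<open>
  Take the first closer \<open>b\<close> whose arc is crossed. An arc that crosses it from the left would end inside
  it, at an earlier closer that is crossed as well; hence the crossing arc leaves to the right, and no
  arc that closes before \<open>b\<close> is crossed.
\<close>
lemma crossing_witness: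
  assumes "\<not> noncrossing f"
  obtains b c where "b \<in> closers" "f b < c" "c < b" "b < f c"
    and "\<And>j r. j < b \<Longrightarrow> f j < r \<Longrightarrow> r < j \<Longrightarrow> f j \<le> f r \<and> f r \<le> j"
proof -
  define bad where "bad b \<longleftrightarrow> (\<exists>r. f b < r \<and> r < b \<and> (f r < f b \<or> b < f r))" for b
  from assms obtain a c where ac: "a < c" "c < f a" "\<not> (a < f c \<and> f c < f a \<and> f c \<noteq> c)"
    by (auto simp: noncrossing_def)
  have "a \<in> {1..n}" using ac mate_outside[of a] by auto
  then have "c \<in> {1..n}" using ac mate_in_iff[of a] by auto
  then have "f c \<noteq> c" by (rule mate_inside)
  moreover have "f c \<noteq> a" "f c \<noteq> f a" using ac mate_mate by (metis nat_neq_iff)+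
  ultimately have "bad (f a)" using ac unfolding bad_def mate_mate by force
  then have bad: "bad (LEAST b. bad b)" by (rule LeastI)
  define b where "b = (LEAST b. bad b)"
  have min: "\<not> bad j" if "j < b" for j using that not_less_Least by (simp add: b_def)
  from bad obtain r where r: "f b < r" "r < b" "f r < f b \<or> b < f r"
    by (auto simp: bad_def b_def)
  have "\<not> f r < f b"
  proof
    assume less: "f r < f b"
    then have "bad r" unfolding bad_def using r mate_mate by (intro exI[of _ "f b"]) auto
    then show False using min[OF r(2)] by contradiction
  qed
  then have "b < f r" using r(3) by blast
  moreover have "b \<in> closers" using r mate_outside[of b] by (auto simp: closers_def)
  ultimately show ?thesis
    using that[of b r] r min unfolding bad_def by (meson not_less)
qed

text \<open>
  A crossing yields one more independent column, that of the opener \<open>f b\<close>. Suppose that a kernel vector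
  vanishes at \<open>0\<close> and at all other openers. Tracing the heights before \<open>b\<close> back through the closers never
  jumps over \<open>c\<close>, so the height at \<open>b - 1\<close> vanishes. It equals the height at \<open>f b\<close>, so the
  vector vanishes at every opener and is zero.
\<close>
lemma rank_incidence_crossing:
  assumes "\<not> noncrossing f"
  shows "card openers \<le> vec_space.rank n incidence"
proof -
  interpret vec_space "TYPE(real)" n .
  from crossing_witness[OF assms] obtain b c where b: "b \<in> closers" "f b < c" "c < b" "b < f c"
    and min: "\<And>j r. j < b \<Longrightarrow> f j < r \<Longrightarrow> r < j \<Longrightarrow> f j \<le> f r \<and> f r \<le> j"
    by blast
  have bn: "b \<le> n" "n > 0" using b(1) by (auto simp: closers_def)
  have a: "f b \<in> openers" "f b < n"
    using b bn mate_in_iff[of b] by (auto simp: openers_def closers_def mate_mate)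
  define J where "J = insert (f b) (closers - {n})"
  have "card J \<le> rank incidence"
  proof (rule card_le_rank[OF incidence_carrier])
    show "J \<subseteq> {..<n}" using a by (auto simp: J_def closers_def)
    fix u :: "nat \<Rightarrow> real" and j
    assume u: "\<And>j. j \<notin> J \<Longrightarrow> u j = 0"
      and kernel: "\<And>i. i < n \<Longrightarrow> (\<Sum>j<n. incidence $$ (i, j) * u j) = 0"
      and j: "j \<in> J"
    have between: "c \<le> j \<Longrightarrow> j < b \<Longrightarrow> u j = 0" for j
    proof (induction j rule: less_induct)
      case (less j)
      show ?case
      proof (cases "j \<in> closers")
        case True
        then have fj: "f j < j" by (simp add: closers_def)
        have "f j > c"
        proof (rule ccontr)
          assume "\<not> c < f j"
          moreover have "f j \<noteq> c" using mate_mate[of j] b(4) less.prems by auto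
          moreover have "j \<noteq> c" using fj b by auto
          ultimately have "f c \<le> j" using min[of j c] less.prems by simp
          then show False using b less.prems by simp
        qed
        then have "u (f j - 1) = 0" using less fj by (intro less.IH) auto
        then show ?thesis using kernel_step_closer[OF kernel True] less.prems bn by simp
      next
        case False
        then show ?thesis using b less.prems by (intro u) (auto simp: J_def)
      qed
    qed
    have "u (f b) = u (b - 1)"
      using kernel_step[OF kernel, of b] b a by (simp add: closers_def)
    also have "\<dots> = 0" using b by (intro between) auto
    finally have "u (f b) = 0" .
    then have "u j = 0" if "j \<notin> closers" for j
      using u that by (cases "j = f b") (auto simp: J_def)
    from kernel_zero[OF kernel this] show "u j = 0" using j a by (auto simp: J_def closers_def)
  qed
  moreover have "card J = card openers"
  proof -
    have "f b \<notin> closers" using a openers_un_closers(2) by auto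
    then have "card J = Suc (card (closers - {n}))" by (simp add: J_def)
    also have "\<dots> = card closers"
      using last_in_closers[OF bn(2)] by (simp add: card_Suc_Diff1 del: card_Diff_insert)
    finally show ?thesis by (simp add: card_closers)
  qed
  ultimately show ?thesis by simp
qed

text \<open>
  The interval spanned by an arc is invariant under the involution.
\<close>
lemma noncrossing_interval:
  assumes "noncrossing f" "c \<in> openers" "c \<le> q" "q \<le> f c"
  shows "c \<le> f q" "f q \<le> f c"
proof -
  have "c \<le> f q \<and> f q \<le> f c"
  proof (cases "q = c \<or> q = f c")
    case True
    then show ?thesis using assms(2) mate_mate by (auto simp: openers_def)
  next
    case False
    then show ?thesis using noncrossingD(1,2)[OF assms(1), of c q] assms(3,4) by auto
  qed
  then show "c \<le> f q" "f q \<le> f c" by auto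
qed

text \<open>
  If arcs do not cross, the columns from an opener \<open>c\<close> up to \<open>f c - 1\<close> add up to zero: the step function
  that is raised by \<open>1\<close> between the two ends of the arc is in the kernel. The sum of all columns is zero
  too. Each such relation expresses a column by columns further to the right, so by downward induction
  the columns of the closers below \<open>n\<close> span everything.
\<close>
lemma rank_incidence_noncrossing:
  assumes nc: "noncrossing f" and "n > 0"
  shows "vec_space.rank n incidence = card openers - 1"
proof (rule antisym[OF _ rank_incidence_ge])
  interpret vec_space "TYPE(real)" n .
  define J where "J = closers - {n}"
  let ?U = "col incidence ` J"
  have J: "J \<subseteq> {..<n}" by (auto simp: J_def closers_def)
  have carrier: "?U \<subseteq> carrier_vec n" using J incidence_carrier by auto
  have entry: "vec_index (col incidence j) i = incidence $$ (i, j)" if "i < n" "j < n" for i j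
    using that incidence_carrier by auto
  \<comment> \<open>a sum of columns over an invariant index set vanishes, which eliminates the leftmost of them\<close>
  have dependent: "col incidence j \<in> span ?U"
    if j: "j < n" and T: "T \<subseteq> {j<..<n}" and IH: "\<And>i. i \<in> T \<Longrightarrow> col incidence i \<in> span ?U"
      and zero: "\<And>i. i < n \<Longrightarrow> i \<in> insert j T \<longleftrightarrow> f (i + 1) mod n \<in> insert j T" for j T
  proof (rule neg_sum_in_span[OF carrier _ IH])
    show fin: "finite T" using T finite_subset by blast
    show "col incidence j \<in> carrier_vec n" by (rule carrier_vecI) (simp add: incidence_def)
    fix r assume r: "r < n"
    have "(\<Sum>i\<in>insert j T. incidence $$ (r, i)) = (\<Sum>i<n. incidence $$ (r, i) * of_bool (i \<in> insert j T))"
      by (rule sum.mono_neutral_cong_left) (use T j in auto)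
    also have "\<dots> = 0" by (simp only: incidence_row[OF r] zero[OF r] diff_self)
    finally have "incidence $$ (r, j) + (\<Sum>i\<in>T. incidence $$ (r, i)) = 0"
      using fin T by (subst (asm) sum.insert) auto
    moreover have "(\<Sum>i\<in>T. incidence $$ (r, i)) = (\<Sum>i\<in>T. vec_index (col incidence i) r)"
      by (rule sum.cong) (use T r entry in auto)
    ultimately show "vec_index (col incidence j) r = - (\<Sum>i\<in>T. vec_index (col incidence i) r)"
      using entry r j by (simp add: eq_neg_iff_add_eq_0)
  qed
  have "col incidence j \<in> span ?U" if "j < n" for j
    using that
  proof (induction "n - j" arbitrary: j rule: less_induct)
    case less
    have IH: "col incidence i \<in> span ?U" if "i \<in> {j<..<n}" for i
      using that by (intro less.hyps) auto
    consider "j = 0" | "j \<in> openers" | "j \<in> J"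
      using openers_un_closers(1) less.prems by (force simp: J_def)
    then show ?case
    proof cases
      case 1
      show ?thesis
        by (rule dependent[of _ "{j<..<n}"]) (use 1 less.prems IH in auto)
    next
      case 2
      define T where "T = {j<..<f j}"
      have fj: "j < f j" "f j \<le> n" "j \<ge> 1"
        using 2 mate_in_iff[of j] by (auto simp: openers_def)
      have T: "insert j T = {j..<f j}" using fj by (auto simp: T_def)
      show ?thesis
      proof (rule dependent[of _ T])
        fix i assume i: "i < n"
        show "i \<in> insert j T \<longleftrightarrow> f (i + 1) mod n \<in> insert j T"
          unfolding T
        proof
          assume "i \<in> {j..<f j}"
          then have "j \<le> f (i + 1)" "f (i + 1) \<le> f j"
            using noncrossing_interval[OF nc 2, of "i + 1"] by auto
          moreover have "f (i + 1) \<noteq> f j" using \<open>i \<in> {j..<f j}\<close> mate_mate[of "i + 1"] mate_mate[of j] by auto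
          ultimately show "f (i + 1) mod n \<in> {j..<f j}" using fj by auto
        next
          assume m: "f (i + 1) mod n \<in> {j..<f j}"
          have "f (i + 1) \<in> {1..n}" using i mate_in_iff by auto
          then have "f (i + 1) mod n = f (i + 1)"
            using m fj by (cases "f (i + 1) = n") auto
          then have "j \<le> f (i + 1)" "f (i + 1) < f j" using m by auto
          then have "j \<le> i + 1" "i + 1 \<le> f j"
            using noncrossing_interval[OF nc 2, of "f (i + 1)"] by (auto simp: mate_mate)
          moreover have "i + 1 \<noteq> j" using \<open>f (i + 1) < f j\<close> by auto
          ultimately show "i \<in> {j..<f j}" by auto
        qed
      qed (use less.prems IH fj in \<open>auto simp: T_def\<close>)
    next
      case 3
      then show ?thesis using in_own_span carrier by auto
    qed
  qed
  from rank_le_card[OF incidence_carrier J this]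
  show "rank incidence \<le> card openers - 1"
    using last_in_closers[OF \<open>n > 0\<close>] card_closers by (simp add: J_def card_Diff_singleton)
qed

end

section \<open>The integral of a noncrossing pairing\<close>

text \<open>
  Integrate out the last coordinate first. For fixed earlier coordinates it ranges over a translate of the
  unit interval, which has length \<open>1\<close> whatever the translation \<open>g\<close> is.
\<close>
lemma emeasure_unit_shear:
  fixes g :: "nat \<Rightarrow> (nat \<Rightarrow> real) \<Rightarrow> real"
  assumes g: "\<And>i. i < n \<Longrightarrow> g i \<in> borel_measurable (\<Pi>\<^sub>M l\<in>{..<i}. lborel)"
  defines "S m \<equiv> {x \<in> space (\<Pi>\<^sub>M l\<in>{..<m}. lborel). \<forall>i<m. x i + g i (restrict x {..<i}) \<in> {0..1}}"
  shows "S n \<in> sets (\<Pi>\<^sub>M l\<in>{..<n}. lborel)" "emeasure (\<Pi>\<^sub>M l\<in>{..<n}. lborel) (S n) = 1"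
proof -
  have sets: "S m \<in> sets (\<Pi>\<^sub>M l\<in>{..<m}. lborel)" if m: "m \<le> n" for m
  proof -
    have "(\<lambda>x. x i + g i (restrict x {..<i})) \<in> borel_measurable (\<Pi>\<^sub>M l\<in>{..<m}. lborel)" if i: "i < m" for i
    proof (rule borel_measurable_add)
      show "(\<lambda>x. x i) \<in> borel_measurable (\<Pi>\<^sub>M l\<in>{..<m}. lborel)"
        using measurable_component_singleton[of i "{..<m}" "\<lambda>_. lborel"] i by simp
      show "(\<lambda>x. g i (restrict x {..<i})) \<in> borel_measurable (\<Pi>\<^sub>M l\<in>{..<m}. lborel)"
        using i m by (intro measurable_compose[OF measurable_restrict_subset g]) auto
    qed
    from measurable_sets[OF this atLeastAtMost_borel[of 0 1]]
    have "{x \<in> space (\<Pi>\<^sub>M l\<in>{..<m}. lborel). x i + g i (restrict x {..<i}) \<in> {0..1}}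
        \<in> sets (\<Pi>\<^sub>M l\<in>{..<m}. lborel)" if "i \<in> {..<m}" for i
      using that by (simp only: vimage_def Int_def mem_Collect_eq conj_commute lessThan_iff)
    then have "{x \<in> space (\<Pi>\<^sub>M l\<in>{..<m}. lborel). \<forall>i\<in>{..<m}. x i + g i (restrict x {..<i}) \<in> {0..1}}
        \<in> sets (\<Pi>\<^sub>M l\<in>{..<m}. lborel)"
      by (rule sets.sets_Collect_finite_All) simp_all
    then show ?thesis by (simp only: S_def Ball_def lessThan_iff)
  qed
  then show "S n \<in> sets (\<Pi>\<^sub>M l\<in>{..<n}. lborel)" by blast
  interpret product_sigma_finite "\<lambda>_::nat. lborel :: real measure"
    by (simp add: product_sigma_finite_def lborel.sigma_finite_measure_axioms)
  have "m \<le> n \<Longrightarrow> emeasure (\<Pi>\<^sub>M l\<in>{..<m}. lborel) (S m) = 1" for m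
  proof (induction m)
    case 0
    have "S 0 = {\<lambda>_. undefined}" by (auto simp: S_def space_PiM)
    then show ?case by simp
  next
    case (Suc m)
    have slice: "indicator (S (Suc m)) (x(m := y)) = indicator (S m) x * (indicator {- g m x..1 - g m x} y :: ennreal)"
      if x: "x \<in> space (\<Pi>\<^sub>M l\<in>{..<m}. lborel)" for x y
    proof -
      have "x(m := y) \<in> space (\<Pi>\<^sub>M l\<in>{..<Suc m}. lborel)"
        using x by (auto simp: space_PiM PiE_iff extensional_def)
      moreover have "restrict (x(m := y)) {..<i} = restrict x {..<i}" if "i \<le> m" for i
        using that by (auto simp: restrict_def)
      moreover have "restrict x {..<m} = x"
        using x by (simp add: space_PiM PiE_iff extensional_restrict)
      ultimately have "x(m := y) \<in> S (Suc m) \<longleftrightarrow> x \<in> S m \<and> y \<in> {- g m x..1 - g m x}"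
        using x by (auto simp: S_def less_Suc_eq)
      then show ?thesis by (simp split: split_indicator)
    qed
    have "emeasure (\<Pi>\<^sub>M l\<in>{..<Suc m}. lborel) (S (Suc m))
        = (\<integral>\<^sup>+ x. indicator (S (Suc m)) x \<partial>(\<Pi>\<^sub>M l\<in>insert m {..<m}. lborel))"
      using sets[OF Suc.prems] by (simp add: lessThan_Suc)
    also have "\<dots> = (\<integral>\<^sup>+ x. (\<integral>\<^sup>+ y. indicator (S (Suc m)) (x(m := y)) \<partial>lborel) \<partial>(\<Pi>\<^sub>M l\<in>{..<m}. lborel))"
      by (rule product_nn_integral_insert)
        (use sets[OF Suc.prems] in \<open>simp_all add: lessThan_Suc borel_measurable_indicator\<close>)
    also have "\<dots> = (\<integral>\<^sup>+ x. indicator (S m) x \<partial>(\<Pi>\<^sub>M l\<in>{..<m}. lborel))"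
      by (rule nn_integral_cong) (simp add: slice nn_integral_cmult_indicator)
    also have "\<dots> = 1" using Suc sets[of m] by simp
    finally show ?case .
  qed
  then show "emeasure (\<Pi>\<^sub>M l\<in>{..<n}. lborel) (S n) = 1" by simp
qed

context pairing
begin

definition sign :: "nat \<Rightarrow> real" where "sign q = (if q < f q then 1 else - 1)"

definition label :: "nat \<Rightarrow> nat" where "label q = card {p \<in> openers. p \<le> min q (f q)}"

text \<open>
  The argument of the indicator functions in the moment formula: each arc carries one variable, which is
  added at its opener and subtracted at its closer.
\<close>
definition height :: "(nat \<Rightarrow> real) \<Rightarrow> nat \<Rightarrow> real" where
  "height x j = x 0 + (\<Sum>q = 1..j. sign q * x (label q))"

definition opener :: "nat \<Rightarrow> nat" where "opener i = inv_into openers label i"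

lemma height_0: "height x 0 = x 0"
  by (simp add: height_def)

lemma height_opener:
  assumes "p \<in> openers"
  shows "height x p = height x (p - 1) + x (label p)"
proof -
  have "sign p = 1" "p \<noteq> 0" using assms by (simp_all add: openers_def sign_def)
  then show ?thesis by (cases p) (simp_all add: height_def)
qed

text \<open>
  Without crossings, every arc that has an end between \<open>f j\<close> and \<open>j\<close> has both ends there, so its two
  contributions cancel.
\<close>
lemma height_closer:
  assumes nc: "noncrossing f" and j: "j \<in> closers"
  shows "height x j = height x (f j - 1)"
proof -
  have op: "f j \<in> openers" "f (f j) = j" "1 \<le> f j" "f j \<le> j" "j \<le> n"
    using j mate_in_iff[of j] by (auto simp: openers_def closers_def mate_mate)
  define h where "h q = sign q * x (label q)" for q
  have h: "h (f q) = - h q" if "q \<in> {f j..j}" for q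
  proof -
    have "f q \<noteq> q" using that op by (intro mate_inside) auto
    then show ?thesis by (simp add: h_def sign_def label_def mate_mate min.commute not_less_iff_gr_or_eq)
  qed
  have "sum h {f j..j} = (\<Sum>q\<in>{f j..j}. h (f q))"
    by (rule sum.reindex_bij_witness[of _ f f])
      (use noncrossing_interval[OF nc op(1)] op in \<open>auto simp: mate_mate\<close>)
  also have "\<dots> = - sum h {f j..j}" by (simp add: h sum_negf)
  finally have zero: "sum h {f j..j} = 0" by simp
  have split: "{1..j} = {1..f j - 1} \<union> {f j..j}" using op by auto
  have "sum h {1..j} = sum h {1..f j - 1} + sum h {f j..j}"
    unfolding split by (rule sum.union_disjoint) (use op in auto)
  then show ?thesis using zero by (simp add: height_def h_def)
qed

lemma label_opener_less:
  assumes "p \<in> openers" "q < p"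
  shows "label q < label p"
proof -
  have "{r \<in> openers. r \<le> min q (f q)} \<subseteq> {r \<in> openers. r \<le> min p (f p)}"
    using assms by (auto simp: openers_def)
  moreover have "p \<in> {r \<in> openers. r \<le> min p (f p)}" "p \<notin> {r \<in> openers. r \<le> min q (f q)}"
    using assms by (auto simp: openers_def)
  ultimately show ?thesis unfolding label_def by (intro psubset_card_mono) auto
qed

lemma bij_betw_label: "bij_betw label openers {1..card openers}"
proof -
  have inj: "inj_on label openers"
    by (metis inj_onI label_opener_less nat_neq_iff)
  have "label p \<in> {1..card openers}" if "p \<in> openers" for p
  proof -
    have "p \<in> {r \<in> openers. r \<le> min p (f p)}" using that by (auto simp: openers_def)
    then have "label p > 0" unfolding label_def by (subst card_gt_0_iff) auto
    moreover have "label p \<le> card openers" unfolding label_def by (rule card_mono) auto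
    ultimately show ?thesis by simp
  qed
  then have "label ` openers = {1..card openers}"
    by (intro card_subset_eq) (auto simp: card_image[OF inj])
  with inj show ?thesis by (simp add: bij_betw_def)
qed

lemma opener:
  assumes "i \<in> {1..card openers}"
  shows "opener i \<in> openers" "label (opener i) = i"
  using assms bij_betw_label unfolding opener_def bij_betw_def
  by (metis inv_into_into, metis f_inv_into_f)

lemma opener_label: "p \<in> openers \<Longrightarrow> opener (label p) = p"
  unfolding opener_def using bij_betw_label by (simp add: bij_betw_def inv_into_f_f)

text \<open>
  The height from which the \<open>i\<close>-th opener starts. With the value \<open>0\<close> for \<open>i = 0\<close>, the condition on the
  initial height \<open>x 0\<close> takes the same form as the condition at an opener.
\<close>
definition offset :: "nat \<Rightarrow> (nat \<Rightarrow> real) \<Rightarrow> real" where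
  "offset i x = (if i = 0 then 0 else height x (opener i - 1))"

lemma label_before_opener:
  assumes "i \<in> {1..card openers}" "q \<in> {1..opener i - 1}"
  shows "label q < i"
  using label_opener_less[OF opener(1)[OF assms(1)], of q] opener(2)[OF assms(1)] assms(2) by auto

lemma offset_restrict:
  assumes "i \<le> card openers"
  shows "offset i (restrict x {..<i}) = offset i x"
  using assms label_before_opener[of i] by (auto simp: offset_def height_def intro!: sum.cong)

lemma measurable_offset:
  assumes i: "i \<le> card openers"
  shows "offset i \<in> borel_measurable (\<Pi>\<^sub>M l\<in>{..<i}. lborel)"
proof (cases "i = 0")
  case False
  have comp: "(\<lambda>x. x l) \<in> borel_measurable (\<Pi>\<^sub>M l\<in>{..<i}. lborel)" if "l < i" for l
    using measurable_component_singleton[of l "{..<i}" "\<lambda>_. lborel"] that by simp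
  have summand: "(\<lambda>x. sign q * x (label q)) \<in> borel_measurable (\<Pi>\<^sub>M l\<in>{..<i}. lborel)"
    if "q \<in> {1..opener i - 1}" for q
  proof -
    have "label q < i" using False i that by (intro label_before_opener) auto
    from borel_measurable_times[OF borel_measurable_const comp[OF this]] show ?thesis .
  qed
  have "(\<lambda>x. \<Sum>q = 1..opener i - 1. sign q * x (label q)) \<in> borel_measurable (\<Pi>\<^sub>M l\<in>{..<i}. lborel)"
    by (rule borel_measurable_sum) (rule summand)
  moreover have "(\<lambda>x. x 0) \<in> borel_measurable (\<Pi>\<^sub>M l\<in>{..<i}. lborel)"
    using False by (intro comp) simp
  ultimately have "(\<lambda>x. x 0 + (\<Sum>q = 1..opener i - 1. sign q * x (label q)))
      \<in> borel_measurable (\<Pi>\<^sub>M l\<in>{..<i}. lborel)"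
    by (rule borel_measurable_add[rotated])
  moreover have "offset i = (\<lambda>x. x 0 + (\<Sum>q = 1..opener i - 1. sign q * x (label q)))"
    using False by (simp add: offset_def height_def fun_eq_iff)
  ultimately show ?thesis by (simp only:)
qed (simp add: offset_def[abs_def])

text \<open>
  In the noncrossing case a closer returns to an earlier height, so only the initial height and the
  openers impose conditions. They force each \<open>x i\<close> with \<open>i \<noteq> 0\<close> to be a difference of two numbers in the
  unit interval, which is why the restriction to \<open>{-1..1}\<close> is automatic.
\<close>
lemma heights_in_unit_interval_iff:
  assumes nc: "noncrossing f" and ext: "x \<in> extensional {0..card openers}"
  shows "x \<in> (\<Pi>\<^sub>E l\<in>{0..card openers}. if l = 0 then {0..1} else {-1..1})
      \<and> (\<forall>j\<in>{1..n}. height x j \<in> {0..1})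
    \<longleftrightarrow> (\<forall>i<Suc (card openers). x i + offset i x \<in> {0..1})" (is "?cube \<and> ?walk \<longleftrightarrow> ?shear")
proof
  have step: "x i + offset i x = height x (opener i)" if "i \<in> {1..card openers}" for i
    using height_opener[OF opener(1)[OF that], of x] opener(2)[OF that] that by (simp add: offset_def)
  have range: "opener i \<in> {1..n}" if "i \<in> {1..card openers}" for i
    using opener(1)[OF that] by (simp add: openers_def)
  show ?shear if cw: "?cube \<and> ?walk"
  proof (intro allI impI)
    fix i assume "i < Suc (card openers)"
    then consider "i = 0" | "i \<in> {1..card openers}" by force
    then show "x i + offset i x \<in> {0..1}"
    proof cases
      case 1
      from cw have ?cube by (rule conjunct1)
      from PiE_mem[OF this, of 0] show ?thesis using 1 by (simp add: offset_def)
    next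
      case 2
      then show ?thesis using step range cw by simp
    qed
  qed
  show "?cube \<and> ?walk" if shear: ?shear
  proof
    have h: "height x j \<in> {0..1}" if "j \<le> n" for j
      using that
    proof (induction j rule: less_induct)
      case (less j)
      consider "j = 0" | "j \<in> openers" | "j \<in> closers"
        using openers_un_closers(1) less.prems by force
      then show ?case
      proof cases
        case 1
        then show ?thesis using shear by (auto simp: height_0 offset_def dest: spec[of _ 0])
      next
        case 2
        then have label: "label j \<in> {1..card openers}"
          using bij_betw_label by (auto simp: bij_betw_def)
        then have "x (label j) + offset (label j) x \<in> {0..1}" using shear by simp
        then show ?thesis unfolding step[OF label] opener_label[OF 2] .
      next
        case 3
        then have "f j - 1 < j" by (auto simp: closers_def)
        then show ?thesis using less height_closer[OF nc 3] by simp
      qed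
    qed
    then show ?walk by auto
    have "x i \<in> (if i = 0 then {0..1} else {-1..1})" if "i \<le> card openers" for i
    proof (cases "i = 0")
      case True
      then show ?thesis using h[of 0] by (simp add: height_0)
    next
      case False
      then have i: "i \<in> {1..card openers}" using that by auto
      have "x i = height x (opener i) - height x (opener i - 1)"
        using step[OF i] False by (simp add: offset_def)
      moreover have "opener i \<le> n" "opener i - 1 \<le> n" using range[OF i] by auto
      ultimately show ?thesis using h[of "opener i"] h[of "opener i - 1"] False by simp
    qed
    then show ?cube using ext by (auto simp: PiE_iff)
  qed
qed

text \<open>
  The openers are labelled from left to right, so the \<open>i\<close>-th condition involves \<open>x i\<close> only through a
  translation that depends on \<open>x 0, \<dots>, x (i - 1)\<close>. This is the situation of \<open>emeasure_unit_shear\<close>.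
\<close>
lemma integral_heights_noncrossing:
  assumes nc: "noncrossing f"
  shows "(LINT x : (\<Pi>\<^sub>E l\<in>{0..card openers}. if l = 0 then {0..1} else {-1..1})
      | (\<Pi>\<^sub>M l\<in>{0..card openers}. lborel). (\<Prod>j = 1..n. indicat_real {0..1} (height x j))) = 1"
proof -
  define k where "k = card openers"
  define M :: "(nat \<Rightarrow> real) measure" where "M = (\<Pi>\<^sub>M l\<in>{..<Suc k}. lborel)"
  define S where "S = {x \<in> space M. \<forall>i<Suc k. x i + offset i (restrict x {..<i}) \<in> {0..1}}"
  have S: "S \<in> sets M" "emeasure M S = 1"
    unfolding S_def M_def k_def by (rule emeasure_unit_shear; simp add: measurable_offset)+
  have index: "{0..k} = {..<Suc k}" by auto
  have "(LINT x : (\<Pi>\<^sub>E l\<in>{0..k}. if l = 0 then {0..1} else {-1..1}) | M.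
      (\<Prod>j = 1..n. indicat_real {0..1} (height x j))) = (LINT x|M. indicat_real S x)"
    unfolding set_lebesgue_integral_def
  proof (rule Bochner_Integration.integral_cong[OF refl])
    fix x assume x: "x \<in> space M"
    then have ext: "x \<in> extensional {0..k}" by (simp add: M_def space_PiM PiE_iff index)
    define W where "W \<longleftrightarrow> (\<forall>j\<in>{1..n}. height x j \<in> {0..1})"
    define C :: "(nat \<Rightarrow> real) set" where "C = (\<Pi>\<^sub>E l\<in>{0..k}. if l = 0 then {0..1} else {-1..1})"
    have prod: "(\<Prod>j = 1..n. indicat_real {0..1} (height x j)) = of_bool W"
      unfolding W_def
      by (cases "\<forall>j\<in>{1..n}. height x j \<in> {0..1}") (auto simp: indicator_def intro!: prod_zero)
    have "x \<in> S \<longleftrightarrow> (\<forall>i<Suc k. x i + offset i x \<in> {0..1})"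
      using x by (simp add: S_def offset_restrict k_def less_Suc_eq_le)
    also have "\<dots> \<longleftrightarrow> x \<in> C \<and> W"
      unfolding C_def W_def k_def
      by (rule heights_in_unit_interval_iff[OF nc ext[unfolded k_def], symmetric])
    finally have "indicat_real C x *\<^sub>R of_bool W = indicat_real S x"
      by (simp add: indicator_def)
    then show "indicat_real (\<Pi>\<^sub>E l\<in>{0..k}. if l = 0 then {0..1} else {-1..1}) x
        *\<^sub>R (\<Prod>j = 1..n. indicat_real {0..1} (height x j)) = indicat_real S x"
      by (simp only: prod C_def)
  qed
  also have "\<dots> = 1" using S by (simp add: measure_def)
  finally show ?thesis by (simp only: M_def k_def[symmetric] index)
qed

end

section \<open>Pair partitions as involutions\<close>

text \<open>
  The value of \<^const>\<open>partner\<close> is meaningless outside \<open>{1..N}\<close>; the identity there makes the law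
  \<open>f (f q) = q\<close> unconditional.
\<close>
definition mate :: "nat \<Rightarrow> nat set set \<Rightarrow> nat \<Rightarrow> nat" where
  "mate N P q = (if q \<in> {1..N} then partner P q else q)"

lemma block_of_eqI:
  assumes "P \<in> pair_partitions N" "V \<in> P" "q \<in> V"
  shows "block_of P q = V"
  unfolding block_of_def
proof (rule the_equality)
  fix W assume "W \<in> P \<and> q \<in> W"
  then show "W = V"
    using assms disjointD[of P W V] by (auto simp: pair_partitions_def partition_on_def)
qed (use assms in simp)

lemma partner_eqI:
  assumes "P \<in> pair_partitions N" "{q, p} \<in> P" "p \<noteq> q"
  shows "partner P q = p"
  unfolding partner_def block_of_eqI[OF assms(1,2) insertI1] using assms(3) by (intro the_equality) auto

lemma block_of_pair:
  assumes P: "P \<in> pair_partitions N" and q: "q \<in> {1..N}"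
  shows "block_of P q = {q, mate N P q}" "{q, mate N P q} \<in> P" "mate N P q \<noteq> q" "mate N P q \<in> {1..N}"
proof -
  have union: "\<Union> P = {1..N}" using P by (simp add: pair_partitions_def partition_on_def)
  then obtain V where V: "V \<in> P" "q \<in> V" using q by blast
  then have "card V = 2" using P by (simp add: pair_partitions_def)
  then obtain p where p: "V = {q, p}" "p \<noteq> q" using V(2) by (auto simp: card_2_iff)
  then have "partner P q = p" using P V(1) by (intro partner_eqI) auto
  then have mate: "mate N P q = p" using q by (simp only: mate_def if_True)
  show "block_of P q = {q, mate N P q}" using block_of_eqI[OF P V] p(1) mate by simp
  show "{q, mate N P q} \<in> P" "mate N P q \<noteq> q" using V(1) p mate by simp_all
  show "mate N P q \<in> {1..N}" unfolding mate using V(1) p(1) union by blast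
qed

lemma pairing_mate:
  assumes P: "P \<in> pair_partitions N"
  shows "pairing N (mate N P)"
proof
  show outside: "mate N P q = q" if "q \<notin> {1..N}" for q using that by (simp only: mate_def if_False)
  show "mate N P q \<noteq> q" if "q \<in> {1..N}" for q using block_of_pair(3)[OF P that] .
  show "mate N P (mate N P q) = q" for q
  proof (cases "q \<in> {1..N}")
    case True
    note b = block_of_pair[OF P True]
    have "partner P (mate N P q) = q"
      using b by (intro partner_eqI[OF P]) (simp_all add: insert_commute)
    then show ?thesis using b(4) by (simp only: mate_def[of N P "mate N P q"] if_True)
  next
    case False
    then show ?thesis by (simp only: outside[OF False])
  qed
qed

lemma pair_partition_eq_mate_pairs:
  assumes P: "P \<in> pair_partitions N"
  shows "P = (\<lambda>q. {q, mate N P q}) ` {1..N}"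
proof (intro equalityI subsetI)
  fix V assume V: "V \<in> P"
  then have "V \<subseteq> {1..N}" "V \<noteq> {}"
    using P by (auto simp: pair_partitions_def partition_on_def)
  then obtain q where q: "q \<in> V" "q \<in> {1..N}" by blast
  have "V = {q, mate N P q}"
    using block_of_eqI[OF P V q(1)] block_of_pair(1)[OF P q(2)] by simp
  with q(2) show "V \<in> (\<lambda>q. {q, mate N P q}) ` {1..N}" by blast
next
  fix V assume "V \<in> (\<lambda>q. {q, mate N P q}) ` {1..N}"
  then show "V \<in> P" using block_of_pair(2)[OF P] by blast
qed

lemma pairs_of_pairing:
  assumes "pairing N f"
  shows "(\<lambda>q. {q, f q}) ` {1..N} \<in> pair_partitions N" (is "?P \<in> _")
    and "mate N ((\<lambda>q. {q, f q}) ` {1..N}) = f"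
proof -
  interpret pairing N f by fact
  have "disjoint ?P"
  proof (rule disjointI)
    fix V W assume "V \<in> ?P" "W \<in> ?P" "V \<noteq> W"
    then obtain p q where pq: "V = {p, f p}" "W = {q, f q}" "{p, f p} \<noteq> {q, f q}" by blast
    show "V \<inter> W = {}"
    proof (rule ccontr)
      assume "V \<inter> W \<noteq> {}"
      then have "p = q \<or> p = f q" using pq(1,2) mate_eq_iff[of p q] mate_eq_iff[of p "f q"] mate_mate[of q] by auto
      then show False using pq(3) mate_mate[of q] by (auto simp: insert_commute)
    qed
  qed
  moreover have "\<Union> ?P = {1..N}" using mate_in_iff by blast
  ultimately have "partition_on {1..N} ?P" unfolding partition_on_def by blast
  moreover have "card {q, f q} = 2" if "q \<in> {1..N}" for q
    using mate_inside[OF that] by simp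
  ultimately show P: "?P \<in> pair_partitions N" unfolding pair_partitions_def by blast
  show "mate N ?P = f"
  proof
    fix q
    show "mate N ?P q = f q"
    proof (cases "q \<in> {1..N}")
      case True
      then have "partner ?P q = f q" using mate_inside by (intro partner_eqI[OF P]) blast+
      with True show ?thesis by (simp only: mate_def if_True)
    next
      case False
      then show ?thesis by (simp only: mate_def mate_outside[OF False] if_False)
    qed
  qed
qed

lemma open_matchings_0_iff: "f \<in> open_matchings N 0 \<longleftrightarrow> pairing N f \<and> noncrossing f"
proof -
  have "card {q \<in> {1..N}. f q = q} = 0 \<longleftrightarrow> (\<forall>q\<in>{1..N}. f q \<noteq> q)"
    by (subst card_0_eq) (simp, blast)
  then show ?thesis unfolding open_matchings_def pairing_def by blast
qed

lemma card_noncrossing_pair_partitions: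
  "card {P \<in> pair_partitions N. noncrossing (mate N P)} = walks N 0"
proof -
  have "bij_betw (mate N) {P \<in> pair_partitions N. noncrossing (mate N P)} (open_matchings N 0)"
    by (rule bij_betw_byWitness[where f' = "\<lambda>f. (\<lambda>q. {q, f q}) ` {1..N}"])
      (use pair_partition_eq_mate_pairs[symmetric] pairs_of_pairing pairing_mate open_matchings_0_iff in auto)
  from bij_betw_same_card[OF this] show ?thesis by (simp only: card_open_matchings)
qed

lemma finite_pair_partitions: "finite (pair_partitions N)"
proof (rule finite_subset)
  show "pair_partitions N \<subseteq> Pow (Pow {1..N})"
    by (auto simp: pair_partitions_def partition_on_def)
qed simp

lemma equation_matrix_eq_incidence:
  assumes "P \<in> pair_partitions (2 * k)"
  shows "equation_matrix k P = pairing.incidence (2 * k) (mate (2 * k) P)"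
proof -
  interpret pairing "2 * k" "mate (2 * k) P" using assms by (rule pairing_mate)
  have "partner P (i + 1) = mate (2 * k) P (i + 1)" if "i < 2 * k" for i
    using that by (simp add: mate_def)
  then show ?thesis unfolding equation_matrix_def incidence_def by (intro cong_mat) auto
qed

lemma block_sign_eq:
  assumes P: "P \<in> pair_partitions N" and q: "q \<in> {1..N}"
  shows "block_sign P q = pairing.sign (mate N P) q"
proof -
  interpret pairing N "mate N P" using P by (rule pairing_mate)
  show ?thesis
    using block_of_pair(1,3)[OF P q] by (auto simp: block_sign_def sign_def min_def)
qed

lemma block_label_eq:
  assumes P: "P \<in> pair_partitions N" and q: "q \<in> {1..N}"
  shows "block_label P q = pairing.label N (mate N P) q"
proof -
  interpret pairing N "mate N P" using P by (rule pairing_mate)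
  let ?m = "min q (mate N P q)"
  have "Min (block_of P q) = ?m" using block_of_pair(1)[OF P q] by simp
  moreover have "bij_betw Min {V \<in> P. Min V \<le> ?m} {p \<in> openers. p \<le> ?m}"
  proof (rule bij_betw_byWitness[where f' = "block_of P"])
    have min: "Min V \<in> openers" "block_of P (Min V) = V" if V: "V \<in> P" for V
    proof -
      from V obtain p where p: "p \<in> {1..N}" "V = {p, mate N P p}"
        using pair_partition_eq_mate_pairs[OF P] by blast
      then have "Min V \<in> V" "finite V" by auto
      then show "block_of P (Min V) = V" using block_of_eqI[OF P V] by blast
      have "Min V = p \<or> Min V = mate N P p" using p(2) \<open>Min V \<in> V\<close> by blast
      moreover have "Min V \<le> p" "Min V \<le> mate N P p" using p(2) by auto
      moreover have "mate N P p \<noteq> p" "mate N P p \<in> {1..N}" using block_of_pair[OF P p(1)] by auto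
      ultimately show "Min V \<in> openers" unfolding openers_def using p(1) mate_mate[of p] by auto
    qed
    have op: "block_of P p \<in> P" "Min (block_of P p) = p" if "p \<in> openers" for p
    proof -
      have p: "p \<in> {1..N}" "p < mate N P p" using that by (auto simp: openers_def)
      then show "block_of P p \<in> P" "Min (block_of P p) = p"
        using block_of_pair(1,2)[OF P p(1)] by (simp_all add: min_def)
    qed
    show "\<forall>V\<in>{V \<in> P. Min V \<le> ?m}. block_of P (Min V) = V" using min by blast
    show "\<forall>p\<in>{p \<in> openers. p \<le> ?m}. Min (block_of P p) = p" using op by blast
    show "Min ` {V \<in> P. Min V \<le> ?m} \<subseteq> {p \<in> openers. p \<le> ?m}" using min by blast
    show "block_of P ` {p \<in> openers. p \<le> ?m} \<subseteq> {V \<in> P. Min V \<le> ?m}" using op by auto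
  qed
  ultimately show ?thesis
    by (simp only: block_label_def label_def bij_betw_same_card)
qed

lemma toeplitz_integral_noncrossing:
  assumes P: "P \<in> pair_partitions (2 * k)" and nc: "noncrossing (mate (2 * k) P)"
  shows "toeplitz_integral k P = 1"
proof -
  interpret pairing "2 * k" "mate (2 * k) P" using P by (rule pairing_mate)
  have k: "card openers = k" using card_openers by simp
  have "x 0 + (\<Sum>q = 1..j. block_sign P q * x (block_label P q)) = height x j"
    if "j \<in> {1..2 * k}" for x j
    unfolding height_def using that
    by (intro arg_cong2[where f = "(+)"] refl sum.cong) (simp_all add: block_sign_eq[OF P] block_label_eq[OF P])
  then have "(\<Prod>j = 1..2 * k. indicat_real {0..1} (x 0 + (\<Sum>q = 1..j. block_sign P q * x (block_label P q))))
      = (\<Prod>j = 1..2 * k. indicat_real {0..1} (height x j))" for x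
    by (intro prod.cong) simp_all
  then show ?thesis
    using integral_heights_noncrossing[OF nc] unfolding toeplitz_integral_def k by (simp only:)
qed

lemma equation_rank_noncrossing:
  assumes P: "P \<in> pair_partitions (2 * k)" and "noncrossing (mate (2 * k) P)" "k \<ge> 1"
  shows "equation_rank k P = k - 1"
proof -
  interpret pairing "2 * k" "mate (2 * k) P" using P by (rule pairing_mate)
  have "card openers = k" using card_openers by simp
  then show ?thesis
    using rank_incidence_noncrossing[OF assms(2)] assms(3)
    by (simp add: equation_rank_def equation_matrix_eq_incidence[OF P])
qed

lemma equation_rank_crossing:
  assumes P: "P \<in> pair_partitions (2 * k)" and "\<not> noncrossing (mate (2 * k) P)"
  shows "k \<le> equation_rank k P"
proof -
  interpret pairing "2 * k" "mate (2 * k) P" using P by (rule pairing_mate)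
  have "card openers = k" using card_openers by simp
  then show ?thesis
    using rank_incidence_crossing[OF assms(2)]
    by (simp add: equation_rank_def equation_matrix_eq_incidence[OF P])
qed

section \<open>Convergence of the moments and of the laws\<close>

lemma tendsto_powi_neg:
  assumes "e < 0"
  shows "(\<lambda>m. real m powi e) \<longlonglongrightarrow> 0"
proof -
  have "(\<lambda>m. inverse (real m) ^ nat (- e)) \<longlonglongrightarrow> 0 ^ nat (- e)"
    by (intro tendsto_power lim_inverse_n)
  then show ?thesis using assms by (simp add: power_int_def power_0_left)
qed

text \<open>
  A noncrossing pairing contributes exactly \<open>1\<close> for every positive \<open>m\<close>. A crossing one carries a
  negative power of \<open>m\<close> in front of a constant and disappears in the limit.
\<close>
theorem toeplitz_moment_tendsto:
  assumes k: "k \<ge> 1"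
  shows "(\<lambda>m. toeplitz_moment m k) \<longlonglongrightarrow> real (walks (2 * k) 0)"
proof -
  let ?nc = "\<lambda>P. noncrossing (mate (2 * k) P)"
  have "(\<lambda>m. toeplitz_moment m k) \<longlonglongrightarrow> (\<Sum>P\<in>pair_partitions (2 * k). of_bool (?nc P))"
    unfolding toeplitz_moment_def
  proof (rule tendsto_sum)
    fix P assume P: "P \<in> pair_partitions (2 * k)"
    show "(\<lambda>m. real m powi (int k - 1 - int (equation_rank k P)) * toeplitz_integral k P)
        \<longlonglongrightarrow> of_bool (?nc P)"
    proof (cases "?nc P")
      case True
      have "int k - 1 - int (equation_rank k P) = 0"
        using equation_rank_noncrossing[OF P True k] k by simp
      then show ?thesis using True toeplitz_integral_noncrossing[OF P True] by simp
    next
      case False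
      have "int k - 1 - int (equation_rank k P) < 0" using equation_rank_crossing[OF P False] by simp
      from tendsto_mult_right[OF tendsto_powi_neg[OF this], of "toeplitz_integral k P"] False
      show ?thesis by simp
    qed
  qed
  also have "(\<Sum>P\<in>pair_partitions (2 * k). of_bool (?nc P)) = real (card {P \<in> pair_partitions (2 * k). ?nc P})"
    using finite_pair_partitions[of "2 * k"] by (simp add: of_bool_def sum.If_cases Int_def)
  finally show ?thesis by (simp only: card_noncrossing_pair_partitions)
qed

lemma integrable_power_of_even:
  fixes M :: "real measure"
  assumes "real_distribution M" "\<And>k. k \<ge> 1 \<Longrightarrow> integrable M (\<lambda>x. x ^ (2 * k))"
  shows "integrable M (\<lambda>x. x ^ k)"
proof (cases "k = 0")
  interpret real_distribution M by fact
  case True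
  then show ?thesis by simp
next
  interpret real_distribution M by fact
  case False
  have "integrable M (\<lambda>x. 1 + x ^ (2 * k))" using assms(2)[of k] False by simp
  then show ?thesis
  proof (rule Bochner_Integration.integrable_bound)
    \<comment> \<open>applied below to \<open>t = x ^ k\<close>\<close>
    have "\<bar>t\<bar> \<le> 1 + t\<^sup>2" for t :: real
      using zero_le_power2[of "\<bar>t\<bar> - 1 / 2"] by (simp add: power2_eq_square algebra_simps)
    then show "AE x in M. norm (x ^ k) \<le> norm (1 + x ^ (2 * k))"
      by (intro AE_I2) (simp add: power_even_eq)
  qed simp
qed

lemma odd_moment_symmetric:
  fixes M :: "real measure"
  assumes "real_distribution M" "distr M borel uminus = M" "odd k"
  shows "(LINT x|M. x ^ k) = 0"
proof -
  interpret real_distribution M by fact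
  have "(LINT x|M. x ^ k) = (LINT x|distr M borel uminus. x ^ k)" using assms(2) by simp
  also have "\<dots> = (LINT x|M. (- x) ^ k)" by (rule integral_distr) simp_all
  also have "\<dots> = - (LINT x|M. x ^ k)" using assms(3) by simp
  finally show ?thesis by simp
qed

theorem theorem5p3:
  fixes \<gamma> :: "nat \<Rightarrow> real measure"
  assumes "\<And>m. m \<ge> 1 \<Longrightarrow> is_block_toeplitz_law m (\<gamma> m)"
  shows "weak_conv_m \<gamma> semicircle_law"
proof -
  have law: "real_distribution (\<gamma> (Suc n))" "distr (\<gamma> (Suc n)) borel uminus = \<gamma> (Suc n)"
    "k \<ge> 1 \<Longrightarrow> integrable (\<gamma> (Suc n)) (\<lambda>x. x ^ (2 * k))"
    "k \<ge> 1 \<Longrightarrow> (LINT x|\<gamma> (Suc n). x ^ (2 * k)) = toeplitz_moment (Suc n) k" for n k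
    using assms[of "Suc n"] by (simp_all add: is_block_toeplitz_law_def)
  have "weak_conv_m (\<lambda>n. \<gamma> (Suc n)) semicircle_law"
  proof (rule method_of_moments[where B = 2])
    show "integrable (\<gamma> (Suc n)) (\<lambda>x. x ^ k)" for n k
      by (rule integrable_power_of_even[OF law(1,3)])
    show "(\<lambda>n. LINT x|\<gamma> (Suc n). x ^ k) \<longlonglongrightarrow> (LINT x|semicircle_law. x ^ k)" for k
    proof (cases "even k")
      case True
      then obtain j where j: "k = 2 * j" by blast
      show ?thesis
      proof (cases "j = 0")
        case True
        have "(LINT x|\<gamma> (Suc n). x ^ 0) = 1" for n
        proof -
          interpret real_distribution "\<gamma> (Suc n)" by (rule law)
          show ?thesis using prob_space by simp
        qed
        then show ?thesis using True j semicircle_moment[of 0] by simp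
      next
        case False
        then show ?thesis
          using LIMSEQ_Suc[OF toeplitz_moment_tendsto[of j]]
          by (simp add: j law semicircle_moment)
      qed
    next
      case False
      then show ?thesis
        by (simp add: odd_moment_symmetric[OF law(1,2)] semicircle_moment walks_odd)
    qed
    show "(LINT x|semicircle_law. x ^ (2 * k)) \<le> 2 ^ (2 * k)" for k
    proof -
      have "real (walks (2 * k) 0) \<le> real (2 ^ (2 * k))" using walks_le by (rule of_nat_mono)
      then show ?thesis by (simp add: semicircle_moment)
    qed
  qed (rule law real_distribution_semicircle integrable_semicircle_power)+
  then show ?thesis
    unfolding weak_conv_m_def weak_conv_def by (blast intro: LIMSEQ_imp_Suc)
qed

end
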